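(* Let $N=\bigoplus_{1\le i\le r}F[-\bar\delta_i]/M$ be a finitely generated multigraded right $F$-module, where $\bar\delta_1,\ldots,\bar\delta_r\in\mathbb{N}^n$ and $M\subset\bigoplus_{1\le i\le r}F[-\bar\delta_i]$ is a multigraded right submodule. Fix any monomial ordering of the free right module $F^r$ and let $N'=\bigoplus_{1\le i\le r}F[-\bar\delta_i]/M'$, where $M'=\mathrm{LM}(M)$ is the leading monomial module of $M$. The finitely generated monomial right module $N'$ is isomorphic to a direct sum $\bigoplus_iC_i$ with $C_i=F[-\bar\delta_i]/I_i$, where $I_i$ ($1\le i\le r$) are the monomial right ideals of $F$ such that $M'=\bigoplus_{i=1}^re_iI_i$ (so that $M'$ is isomorphic to $\bigoplus_iI_i$). If each $I_i$ is a regular ideal, then the multigraded Hilbert series $\mathrm{HS}(N)=\sum_{1\le i\le r}\mathrm{HS}(C_i)$ is a rational function with integer coefficients.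
   Context: Let $\mathbb{K}$ be any field, $X=\{x_1,\ldots,x_n\}$ a finite set of variables, $W=X^*$ the free monoid of words over $X$, and $F=\mathbb{K}\langle X\rangle$ the free associative algebra, with $\mathbb{K}$-basis $W$. For $w\in W$, $\deg(w)=(\alpha_1,\ldots,\alpha_n)\in\mathbb{N}^n$ where $\alpha_i$ is the number of occurrences of $x_i$ in $w$. For $\bar\delta\in\mathbb{N}^n$, $F[-\bar\delta]$ is the right $F$-module $F$ multigraded by giving a word $w$ the multidegree $\bar\delta+\deg(w)$. The direct sum $\bigoplus_{1\le i\le r}F[-\bar\delta_i]$ is the free right module $F^r$ with canonical basis $e_1,\ldots,e_r$, multigraded by giving $e_iw$ the multidegree $\bar\delta_i+\deg(w)$. A right submodule $M$ of it is multigraded if $M=\sum_{\bar\alpha}M_{\bar\alpha}$ with $M_{\bar\alpha}=M\cap\bigoplus_iF[-\bar\delta_i]_{\bar\alpha}$; the quotient is then multigraded. The multigraded Hilbert series of a finitely generated multigraded right module $N$ is the power series $\mathrm{HS}(N)=\sum_{\bar\alpha\in\mathbb{N}^n}\dim_{\mathbb{K}}N_{\bar\alpha}\,t_1^{\alpha_1}\cdots t_n^{\alpha_n}$; it is a rational function if it is the expansion of a rational function in $t_1,\ldots,t_n$. The monomials of $F^r$ are the elements of $W(r)=\{e_iw\mid 1\le i\le r,\ w\in W\}$. A monomial ordering of $F^r$ is a well-ordering $\prec$ of $W(r)$ such that $e_iu\prec e_jv$ implies $e_iuw\prec e_jvw$ for all $e_iu,e_jv\in W(r)$ and $w\in W$.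 For $0\ne f\in F^r$, $\mathrm{lm}(f)$ is the $\prec$-greatest monomial occurring in $f$; $\mathrm{LM}(M)$ is the right submodule of $F^r$ generated by $\{\mathrm{lm}(f)\mid f\in M,f\ne0\}$. A right submodule of $F^r$ generated by monomials is called monomial, and the quotient by it a monomial right module. If $\{e_{i_k}w_k\}$ is a monomial generating set of $M'$, then $I_i$ is the right ideal of $F$ generated by $\{w_k\mid e_{i_k}=e_i\}$. A monomial right ideal of $F$ is a right ideal generated by a (possibly infinite) set of words; $\mathcal{MI}$ denotes the set of all of them. For each variable $x_i$, $T_{x_i}:\mathcal{MI}\to\mathcal{MI}$ is $T_{x_i}(I)=(I:_Rx_i)=\{f\in F\mid x_if\in I\}$. The orbit $\mathcal{O}_I$ of $I\in\mathcal{MI}$ is the minimal subset of $\mathcal{MI}$ containing $I$ with $T_{x_i}(\mathcal{O}_I)\subset\mathcal{O}_I$ for all $i$. The ideal $I$ is regular if $\mathcal{O}_I$ is finite. *)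

theory Defs
  imports Complex_Main "HOL-Library.Poly_Mapping" "HOL-Algebra.QuotRing"
begin

section \<open>The free associative algebra\<close>

text \<open>
  Words over \<open>'x\<close> are lists, with concatenation as (noncommutative) addition, so that the
  convolution product of Poly_Mapping on \<open>'x list \<Rightarrow>\<^sub>0 'k\<close> is the product of the free
  associative algebra \<open>K\<langle>X\<rangle>\<close>.
\<close>

instantiation list :: (type) monoid_add
begin
definition zero_list :: "'a list" where "0 = []"
definition plus_list :: "'a list \<Rightarrow> 'a list \<Rightarrow> 'a list" where "u + v = u @ v"
instance by standard (simp_all add: zero_list_def plus_list_def)
end

type_synonym ('x, 'k) free_algebra = "'x list \<Rightarrow>\<^sub>0 'k"
type_synonym 'x multidegree = "'x \<Rightarrow>\<^sub>0 nat"

definition word :: "'x list \<Rightarrow> ('x, 'k::field) free_algebra"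
  where "word w = Poly_Mapping.single w 1"

definition scalar :: "'k \<Rightarrow> ('x, 'k::field) free_algebra"
  where "scalar c = Poly_Mapping.single [] c"

definition mdeg :: "'x list \<Rightarrow> 'x multidegree"
  where "mdeg w = (\<Sum>x\<leftarrow>w. Poly_Mapping.single x 1)"


section \<open>Multigraded right modules\<close>

text \<open>
  \<open>ract N v a\<close> is \<open>v\<close> times the ring element \<open>a\<close>, acting from the right; \<open>hcomp N \<alpha>\<close> is the
  homogeneous component of degree \<open>\<alpha>\<close>. The acting ring is a whole type. The fields
  \<open>mult\<close> and \<open>one\<close> inherited from HOL-Algebra's ring record are meaningless here.
\<close>

record ('v, 'a, 'd) graded_rmodule = "'v ring" +
  ract :: "'v \<Rightarrow> 'a \<Rightarrow> 'v"
  hcomp :: "'d \<Rightarrow> 'v set"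

definition right_submodule :: "('v, 'a, 'd) graded_rmodule \<Rightarrow> 'v set \<Rightarrow> bool"
  where "right_submodule N M \<longleftrightarrow>
    additive_subgroup M N \<and> (\<forall>v\<in>M. \<forall>a. ract N v a \<in> M)"

definition multigraded :: "('v, 'a, 'd) graded_rmodule \<Rightarrow> 'v set \<Rightarrow> bool"
  where "multigraded N M \<longleftrightarrow>
    M = {\<Oplus>\<^bsub>N\<^esub>\<alpha>\<in>A. g \<alpha> | A g. finite A \<and> (\<forall>\<alpha>\<in>A. g \<alpha> \<in> M \<inter> hcomp N \<alpha>)}"

definition quot_rmodule :: "('v, 'a, 'd) graded_rmodule \<Rightarrow> 'v set \<Rightarrow> ('v set, 'a, 'd) graded_rmodule"
  where "quot_rmodule N M =
    \<lparr> carrier = a_rcosets\<^bsub>N\<^esub> M,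
      mult = undefined, one = undefined,
      zero = M,
      add = set_add N,
      ract = (\<lambda>C a. \<Union>v\<in>C. M +>\<^bsub>N\<^esub> ract N v a),
      hcomp = (\<lambda>\<alpha>. (\<lambda>v. M +>\<^bsub>N\<^esub> v) ` hcomp N \<alpha>) \<rparr>"

text \<open>The direct sum of a family of modules, for a finite index set \<open>A\<close>.\<close>

definition dsum_rmodule ::
  "'i set \<Rightarrow> ('i \<Rightarrow> ('v, 'a, 'd) graded_rmodule) \<Rightarrow> ('i \<Rightarrow> 'v, 'a, 'd) graded_rmodule"
  where "dsum_rmodule A N =
    \<lparr> carrier = (\<Pi>\<^sub>E i\<in>A. carrier (N i)),
      mult = undefined, one = undefined,
      zero = (\<lambda>i\<in>A. \<zero>\<^bsub>N i\<^esub>),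
      add = (\<lambda>f g. \<lambda>i\<in>A. f i \<oplus>\<^bsub>N i\<^esub> g i),
      ract = (\<lambda>f a. \<lambda>i\<in>A. ract (N i) (f i) a),
      hcomp = (\<lambda>\<alpha>. \<Pi>\<^sub>E i\<in>A. hcomp (N i) \<alpha>) \<rparr>"

definition graded_isomorphic ::
  "('v, 'a, 'd) graded_rmodule \<Rightarrow> ('w, 'a, 'd) graded_rmodule \<Rightarrow> bool"
  where "graded_isomorphic N N' \<longleftrightarrow>
    (\<exists>\<phi>. bij_betw \<phi> (carrier N) (carrier N') \<and>
      (\<forall>u\<in>carrier N. \<forall>v\<in>carrier N. \<phi> (u \<oplus>\<^bsub>N\<^esub> v) = \<phi> u \<oplus>\<^bsub>N'\<^esub> \<phi> v) \<and>
      (\<forall>v\<in>carrier N. \<forall>a. \<phi> (ract N v a) = ract N' (\<phi> v) a) \<and>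
      (\<forall>\<alpha>. \<phi> ` hcomp N \<alpha> = hcomp N' \<alpha>))"

text \<open>
  \<open>F[-\<delta>]\<close> and \<open>F[-\<delta> 1] \<oplus> \<dots> \<oplus> F[-\<delta> r]\<close>. Elements of the latter are families indexed by
  \<open>{1..r}\<close>, so the internal direct sum of the \<open>e\<^sub>i I\<^sub>i\<close> is \<open>\<Pi>\<^sub>E i\<in>{1..r}. I i\<close>.
\<close>

definition shifted :: "'x multidegree \<Rightarrow>
    (('x, 'k::field) free_algebra, ('x, 'k) free_algebra, 'x multidegree) graded_rmodule"
  where "shifted \<delta> =
    \<lparr> carrier = UNIV,
      mult = undefined, one = undefined,
      zero = 0,
      add = (+),
      ract = (*),
      hcomp = (\<lambda>\<alpha>. {f. \<forall>w\<in>Poly_Mapping.keys f. \<delta> + mdeg w = \<alpha>}) \<rparr>"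

definition free_module :: "nat \<Rightarrow> (nat \<Rightarrow> 'x multidegree) \<Rightarrow>
    (nat \<Rightarrow> ('x, 'k::field) free_algebra, ('x, 'k) free_algebra, 'x multidegree) graded_rmodule"
  where "free_module r \<delta> = dsum_rmodule {1..r} (\<lambda>i. shifted (\<delta> i))"


section \<open>Hilbert series\<close>

text \<open>
  Bases and dimension of a finite-dimensional \<open>K\<close>-subspace \<open>V\<close> of a right module over the free
  algebra. All homogeneous components of finitely generated multigraded modules are
  finite-dimensional; for other \<open>V\<close> the value of \<open>k_dim\<close> is unspecified.
\<close>

definition k_basis ::
  "('v, ('x, 'k::field) free_algebra, 'd) graded_rmodule \<Rightarrow> 'v set \<Rightarrow> 'v set \<Rightarrow> bool"
  where "k_basis N V B \<longleftrightarrow> finite B \<and> B \<subseteq> V \<and>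
    (\<forall>v\<in>V. \<exists>!c. c \<in> B \<rightarrow>\<^sub>E UNIV \<and> v = (\<Oplus>\<^bsub>N\<^esub>b\<in>B. ract N b (scalar (c b))))"

definition k_dim ::
  "('v, ('x, 'k::field) free_algebra, 'd) graded_rmodule \<Rightarrow> 'v set \<Rightarrow> nat"
  where "k_dim N V = (THE d. \<exists>B. k_basis N V B \<and> card B = d)"

text \<open>
  Power series with integer coefficients, in commuting variables \<open>t\<^sub>x\<close> indexed by \<open>x :: 'x\<close>, are
  functions on exponents; polynomials are those of type \<open>'x multidegree \<Rightarrow>\<^sub>0 int\<close>.
\<close>

definition HS ::
  "('v, ('x, 'k::field) free_algebra, 'x multidegree) graded_rmodule \<Rightarrow> 'x multidegree \<Rightarrow> int"
  where "HS N \<alpha> = int (k_dim N (hcomp N \<alpha>))"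

text \<open>The set of pairs \<open>(\<beta>, \<gamma>)\<close> with \<open>\<beta> + \<gamma> = \<alpha>\<close> is finite, so this is the Cauchy product.\<close>

definition series_mult ::
  "('x multidegree \<Rightarrow> int) \<Rightarrow> ('x multidegree \<Rightarrow> int) \<Rightarrow> 'x multidegree \<Rightarrow> int"
  where "series_mult f g \<alpha> = (\<Sum>(\<beta>, \<gamma>) \<in> {(\<beta>, \<gamma>). \<beta> + \<gamma> = \<alpha>}. f \<beta> * g \<gamma>)"

text \<open>
  \<open>S\<close> is the expansion at the origin of \<open>P/Q\<close> with integer polynomials \<open>P\<close>, \<open>Q\<close>; the expansion
  exists because the constant coefficient of \<open>Q\<close> is nonzero.
\<close>

definition is_rational_function :: "('x multidegree \<Rightarrow> int) \<Rightarrow> bool"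
  where "is_rational_function S \<longleftrightarrow>
    (\<exists>P Q :: 'x multidegree \<Rightarrow>\<^sub>0 int. Poly_Mapping.lookup Q 0 \<noteq> 0 \<and>
      series_mult (Poly_Mapping.lookup Q) S = Poly_Mapping.lookup P)"


section \<open>Monomials and leading monomial modules\<close>

text \<open>The monomial \<open>e\<^sub>i w\<close> is encoded as the pair \<open>(i, w)\<close>.\<close>

definition monomials :: "nat \<Rightarrow> (nat \<times> 'x list) set"
  where "monomials r = {1..r} \<times> UNIV"

definition mon_vec :: "nat \<Rightarrow> nat \<times> 'x list \<Rightarrow> nat \<Rightarrow> ('x, 'k::field) free_algebra"
  where "mon_vec r m = (\<lambda>j\<in>{1..r}. if j = fst m then word (snd m) else 0)"

definition occurring :: "nat \<Rightarrow> (nat \<Rightarrow> ('x, 'k::field) free_algebra) \<Rightarrow> (nat \<times> 'x list) set"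
  where "occurring r f = (SIGMA i:{1..r}. Poly_Mapping.keys (f i))"

text \<open>\<open>(m, m') \<in> R\<close> means that \<open>m\<close> is less than \<^emph>\<open>or equal to\<close> \<open>m'\<close>.\<close>

definition monomial_ordering :: "nat \<Rightarrow> (nat \<times> 'x list) rel \<Rightarrow> bool"
  where "monomial_ordering r R \<longleftrightarrow> well_order_on (monomials r) R \<and>
    (\<forall>i u j v w. ((i, u), (j, v)) \<in> R - Id \<longrightarrow> ((i, u @ w), (j, v @ w)) \<in> R - Id)"

definition lm :: "nat \<Rightarrow> (nat \<times> 'x list) rel \<Rightarrow>
    (nat \<Rightarrow> ('x, 'k::field) free_algebra) \<Rightarrow> nat \<times> 'x list"
  where "lm r R f = (THE m. m \<in> occurring r f \<and> (\<forall>m'\<in>occurring r f. (m', m) \<in> R))"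

definition LM :: "nat \<Rightarrow> (nat \<Rightarrow> 'x multidegree) \<Rightarrow> (nat \<times> 'x list) rel \<Rightarrow>
    (nat \<Rightarrow> ('x, 'k::field) free_algebra) set \<Rightarrow> (nat \<Rightarrow> ('x, 'k) free_algebra) set"
  where "LM r \<delta> R M = right_submodule (free_module r \<delta>) hull
    {mon_vec r (lm r R f) | f. f \<in> M \<and> f \<noteq> \<zero>\<^bsub>free_module r \<delta>\<^esub>}"


section \<open>Monomial right ideals\<close>

text \<open>Right ideals are the right submodules of \<open>F\<close>; the shift is irrelevant for this.\<close>

definition monomial_right_ideals :: "('x, 'k::field) free_algebra set set"  (\<open>\<M>\<I>\<close>)
  where "\<M>\<I> = {right_submodule (shifted 0) hull (word ` S) | S. True}"

definition T_var :: "'x \<Rightarrow> ('x, 'k::field) free_algebra set \<Rightarrow> ('x, 'k) free_algebra set"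
  where "T_var x I = {f. word [x] * f \<in> I}"

definition ideal_orbit :: "('x, 'k::field) free_algebra set \<Rightarrow> ('x, 'k) free_algebra set set"
  where "ideal_orbit I = (\<lambda>A. A \<subseteq> \<M>\<I> \<and> (\<forall>x. T_var x ` A \<subseteq> A)) hull {I}"

definition regular_ideal :: "('x, 'k::field) free_algebra set \<Rightarrow> bool"
  where "regular_ideal I \<longleftrightarrow> I \<in> \<M>\<I> \<and> finite (ideal_orbit I)"

end

theory Submission
  imports Defs "HOL-Library.Function_Algebras"
begin

text \<open>
  Write \<open>L\<close> for the set of leading monomials of \<open>M\<close>; it is closed under right multiplication, so
  \<open>LM(M)\<close> is spanned by \<open>L\<close> and \<open>I\<^sub>i\<close> by the words \<open>w\<close> with \<open>e\<^sub>i w \<in> L\<close>. Reduction along the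
  well-ordering shows that the monomials outside \<open>L\<close> form a basis of the free module modulo \<open>M\<close>, and
  since \<open>M\<close> is multigraded this holds in each degree separately. Hence the Hilbert series of both
  quotients counts the monomials outside \<open>L\<close>, which gives the sum formula.

  For rationality, sort the words outside a monomial right ideal \<open>J\<close> by their first letter:
  \<open>H\<^sub>J = c\<^sub>J + (\<Sum>x. t\<^sub>x H\<^bsub>T\<^sub>x J\<^esub>)\<close> with \<open>c\<^sub>J \<in> {0, 1}\<close>. Over the finite orbit of a regular ideal this is a
  linear system whose matrix is the identity plus entries without constant term. Eliminating the
  unknowns one at a time divides only by polynomials with constant coefficient \<open>1\<close>.
\<close>

section \<open>Dimension of coordinate spaces\<close>

text \<open>The dimension in a Hilbert series is a definite description over bases, and the vectors
  are cosets in a record-based module rather than elements of a type. Dimension counts are therefore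
  moved to finitely supported functions \<open>'m \<Rightarrow>\<^sub>0 'k\<close>, where
  \<open>pm.dim\<close> settles that all bases have the same size; \<open>'m\<close> is later taken
  to be words for F and pairs \<open>(i, w)\<close> for F^r. A monomial ordering may ignore degrees,
  so reducing a homogeneous element can produce terms of other degrees. These are removed afterwards
  by projecting onto one degree, which stays inside \<open>M\<close> because \<open>M\<close> is
  multigraded. The set \<open>L\<close> may need infinitely many generators, so finiteness has to
  come from the orbit. A regular ideal has a finite deterministic automaton: the states are the
  ideals in the orbit, the letter \<open>x\<close> acts by \<open>T_var x\<close>, and a state
  accepts if it contains the empty word. The linear system is the usual one for the generating
  function of the rejected words. Apart from the identity, its matrix entries are sums of variables
  and vanish at the origin, hence the constant coefficient \<open>1\<close> of every pivot.\<close>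

definition pscale :: "'k::field \<Rightarrow> ('m \<Rightarrow>\<^sub>0 'k) \<Rightarrow> 'm \<Rightarrow>\<^sub>0 'k"
  where "pscale c f = Poly_Mapping.map ((*) c) f"

lemma lookup_pscale [simp]: "Poly_Mapping.lookup (pscale c f) m = c * Poly_Mapping.lookup f m"
  by (simp add: pscale_def Poly_Mapping.map.rep_eq when_def)

lemma keys_pscale_subset: "Poly_Mapping.keys (pscale c f) \<subseteq> Poly_Mapping.keys f"
  by (auto simp: in_keys_iff)

interpretation pm: vector_space "pscale :: 'k::field \<Rightarrow> ('m \<Rightarrow>\<^sub>0 'k) \<Rightarrow> 'm \<Rightarrow>\<^sub>0 'k"
  by standard (auto intro!: poly_mapping_eqI simp: lookup_add algebra_simps)

lemma subspace_supported: "pm.subspace {g :: 'm \<Rightarrow>\<^sub>0 'k::field. Poly_Mapping.keys g \<subseteq> S}"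
  by (auto simp: pm.subspace_def dest!: subsetD[OF keys_add] subsetD[OF keys_pscale_subset])

lemma sum_pscale_single:
  fixes g :: "'m \<Rightarrow>\<^sub>0 'k::field"
  assumes "finite S"
  shows "Poly_Mapping.lookup (\<Sum>m\<in>S. pscale (c m) (Poly_Mapping.single m 1)) n = (if n \<in> S then c n else 0)"
proof -
  have "Poly_Mapping.lookup (\<Sum>m\<in>S. pscale (c m) (Poly_Mapping.single m 1)) n = (\<Sum>m\<in>S. if m = n then c m else 0)"
    unfolding lookup_sum by (intro sum.cong) (auto simp: lookup_single)
  then show ?thesis using assms by simp
qed

lemma supported_eq_sum:
  fixes g :: "'m \<Rightarrow>\<^sub>0 'k::field"
  assumes "finite S" "Poly_Mapping.keys g \<subseteq> S"
  shows "g = (\<Sum>m\<in>S. pscale (Poly_Mapping.lookup g m) (Poly_Mapping.single m 1))"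
  by (rule poly_mapping_eqI) (use assms in \<open>auto simp: sum_pscale_single in_keys_iff\<close>)

lemma inj_single_one: "inj (\<lambda>m. Poly_Mapping.single m (1::'k::field))"
  by (auto simp: inj_def dest: arg_cong[of _ _ Poly_Mapping.keys])

lemma dim_supported:
  assumes "finite S"
  shows "pm.dim {g :: 'm \<Rightarrow>\<^sub>0 'k::field. Poly_Mapping.keys g \<subseteq> S} = card S"
proof -
  let ?e = "\<lambda>m. Poly_Mapping.single m (1::'k)"
  have inj: "inj_on ?e S" using inj_single_one by (rule inj_on_subset) simp
  have "pm.span (?e ` S) = pm.span {g. Poly_Mapping.keys g \<subseteq> S}"
  proof -
    have "g \<in> pm.span (?e ` S)" if "Poly_Mapping.keys g \<subseteq> S" for g
      by (subst supported_eq_sum[OF assms that])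
        (blast intro: pm.span_sum pm.span_scale pm.span_base)
    then have "{g. Poly_Mapping.keys g \<subseteq> S} \<subseteq> pm.span (?e ` S)" by blast
    moreover have "?e ` S \<subseteq> {g. Poly_Mapping.keys g \<subseteq> S}" by auto
    ultimately show ?thesis
      by (metis pm.span_mono pm.span_minimal pm.subspace_span subset_antisym)
  qed
  moreover have "pm.independent (?e ` S)"
  proof (rule pm.independent_if_scalars_zero)
    fix u x assume *: "(\<Sum>x\<in>?e ` S. pscale (u x) x) = 0" and "x \<in> ?e ` S"
    then obtain n where n: "n \<in> S" "x = ?e n" by auto
    have "(\<Sum>m\<in>S. pscale (u (?e m)) (?e m)) = 0"
      using * by (subst (asm) sum.reindex[OF inj]) (simp add: o_def)
    then have "Poly_Mapping.lookup (\<Sum>m\<in>S. pscale (u (?e m)) (?e m)) n = 0" by simp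
    then show "u x = 0" using n assms by (simp add: sum_pscale_single)
  qed (use assms in simp)
  ultimately have "pm.dim {g :: 'm \<Rightarrow>\<^sub>0 'k. Poly_Mapping.keys g \<subseteq> S} = card (?e ` S)"
    by (rule pm.dim_eq_card)
  then show ?thesis using inj by (simp add: card_image)
qed

text \<open>\<open>\<psi>\<close> is a K-linear isomorphism from a coordinate space onto
  \<open>V\<close>. As \<open>k_dim\<close> is a definite description, two things are needed: some
  basis of size \<open>card S\<close>, namely the images of the unit vectors, and equality of all
  basis sizes, obtained by pulling a basis back along \<open>\<psi>\<close> and using
  \<open>pm.dim\<close>.\<close>

lemma k_dim_eq:
  fixes N :: "('v, ('x, 'k::field) free_algebra, 'd) graded_rmodule"
    and \<psi> :: "('m \<Rightarrow>\<^sub>0 'k) \<Rightarrow> 'v"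
  assumes N: "abelian_monoid N" and S: "finite S"
    and bij: "bij_betw \<psi> {g. Poly_Mapping.keys g \<subseteq> S} V" and V: "V \<subseteq> carrier N"
    and zero: "\<psi> 0 = \<zero>\<^bsub>N\<^esub>"
    and add: "\<And>g h. Poly_Mapping.keys g \<subseteq> S \<Longrightarrow> Poly_Mapping.keys h \<subseteq> S \<Longrightarrow> \<psi> (g + h) = \<psi> g \<oplus>\<^bsub>N\<^esub> \<psi> h"
    and scale: "\<And>c g. Poly_Mapping.keys g \<subseteq> S \<Longrightarrow> \<psi> (pscale c g) = ract N (\<psi> g) (scalar c)"
  shows "k_dim N V = card S"
proof -
  interpret abelian_monoid N by fact
  let ?F = "{g :: 'm \<Rightarrow>\<^sub>0 'k. Poly_Mapping.keys g \<subseteq> S}"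
  let ?e = "\<lambda>m. Poly_Mapping.single m (1::'k)"
  have inj: "inj_on \<psi> ?F" and im: "\<psi> ` ?F = V" using bij by (auto simp: bij_betw_def)
  have F: "pm.subspace ?F" by (rule subspace_supported)
  \<comment> \<open>Linear combinations commute with \<open>\<psi>\<close>. Coefficients are indexed
    by \<open>\<psi> b\<close> because \<open>k_basis\<close> indexes them by module elements;
    injectivity keeps the sum over the image from merging terms.\<close>
  have comb: "(\<Sum>b\<in>B. pscale (c (\<psi> b)) b) \<in> ?F \<and>
      (\<Oplus>\<^bsub>N\<^esub>y\<in>\<psi> ` B. ract N y (scalar (c y))) = \<psi> (\<Sum>b\<in>B. pscale (c (\<psi> b)) b)"
    if "finite B" "B \<subseteq> ?F" for B c
    using that
  proof (induction B)
    case empty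
    then show ?case by (simp add: zero)
  next
    case (insert b B)
    have F': "pscale a g \<in> ?F" if "g \<in> ?F" for a g by (rule pm.subspace_scale[OF F that])
    have mem: "ract N (\<psi> g) (scalar a) \<in> carrier N" if "g \<in> ?F" for a g
    proof -
      have "\<psi> (pscale a g) \<in> carrier N"
        using F'[OF that, of a] im V by blast
      then show ?thesis using that scale[of g a] by simp
    qed
    have *: "(\<Sum>b\<in>insert b B. pscale (c (\<psi> b)) b) =
        pscale (c (\<psi> b)) b + (\<Sum>b\<in>B. pscale (c (\<psi> b)) b)"
      using insert by simp
    have "\<psi> b \<notin> \<psi> ` B" using insert inj by (auto dest: inj_onD)
    then have "(\<Oplus>\<^bsub>N\<^esub>y\<in>\<psi> ` insert b B. ract N y (scalar (c y))) =
        ract N (\<psi> b) (scalar (c (\<psi> b))) \<oplus>\<^bsub>N\<^esub> (\<Oplus>\<^bsub>N\<^esub>y\<in>\<psi> ` B. ract N y (scalar (c y)))"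
      unfolding image_insert using insert mem by (intro finsum_insert) auto
    also have "\<dots> = \<psi> (\<Sum>b\<in>insert b B. pscale (c (\<psi> b)) b)"
      unfolding * using insert F' by (simp add: add scale)
    finally show ?case
      unfolding * using insert pm.subspace_add[OF F] F' by simp
  qed
  have card: "card B' = card S" if B': "k_basis N V B'" for B'
  proof -
    define B where "B = {g \<in> ?F. \<psi> g \<in> B'}"
    have B: "B \<subseteq> ?F" and img: "\<psi> ` B = B'"
      using B' im by (auto simp: B_def k_basis_def)
    have injB: "inj_on \<psi> B" using inj B by (rule inj_on_subset)
    have "finite (\<psi> ` B)" using B' img by (simp add: k_basis_def)
    then have fin: "finite B" using injB by (rule finite_imageD)
    have "?F \<subseteq> pm.span B"
    proof
      fix g assume g: "g \<in> ?F"
      then have "\<psi> g \<in> V" using im by auto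
      then obtain c where "\<psi> g = (\<Oplus>\<^bsub>N\<^esub>b\<in>B'. ract N b (scalar (c b)))"
        using B' unfolding k_basis_def by blast
      then have "\<psi> g = \<psi> (\<Sum>b\<in>B. pscale (c (\<psi> b)) b)"
        using comb[OF fin B, of c] img by simp
      then have "g = (\<Sum>b\<in>B. pscale (c (\<psi> b)) b)"
        using comb[OF fin B, of c] inj g by (meson inj_onD)
      then show "g \<in> pm.span B"
        by (metis (no_types, lifting) pm.span_base pm.span_scale pm.span_sum)
    qed
    then have "pm.span B = pm.span ?F"
      using B by (metis pm.span_mono pm.span_minimal pm.subspace_span subset_antisym)
    moreover have "pm.independent B"
    proof (rule pm.independent_if_scalars_zero[OF fin])
      fix u x assume u: "(\<Sum>x\<in>B. pscale (u x) x) = 0" and x: "x \<in> B"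
      \<comment> \<open>\<open>c\<close> is the relation \<open>u\<close> transported to
        \<open>B'\<close> and \<open>d\<close> is the trivial relation. Both express the zero of
        \<open>N\<close>, so the uniqueness clause of \<open>k_basis\<close> at zero forces them to
        agree.\<close>
      define c where "c = (\<lambda>y\<in>B'. u (inv_into B \<psi> y))"
      define d where "d = (\<lambda>y\<in>B'. 0 :: 'k)"
      have "c (\<psi> b) = u b" "d (\<psi> b) = 0" if "b \<in> B" for b
        using that injB img by (auto simp: c_def d_def)
      then have *: "(\<Sum>b\<in>B. pscale (c (\<psi> b)) b) = 0" "(\<Sum>b\<in>B. pscale (d (\<psi> b)) b) = 0"
        using u by (simp_all cong: sum.cong)
      define P where "P c \<longleftrightarrow> c \<in> B' \<rightarrow>\<^sub>E UNIV \<and> \<zero>\<^bsub>N\<^esub> = (\<Oplus>\<^bsub>N\<^esub>b\<in>B'. ract N b (scalar (c b)))" for c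
      have "P c" "P d"
        using comb[OF fin B, of c] comb[OF fin B, of d] * img zero by (auto simp: P_def c_def d_def)
      moreover have "\<exists>!c. P c"
      proof -
        have "\<psi> 0 \<in> \<psi> ` ?F" by (rule imageI) simp
        then have "\<zero>\<^bsub>N\<^esub> \<in> V" unfolding im zero .
        with B' show ?thesis by (simp add: k_basis_def P_def)
      qed
      ultimately have "c = d" by blast
      then have "c (\<psi> x) = d (\<psi> x)" by (rule arg_cong)
      then show "u x = 0" using x injB img by (auto simp: c_def d_def)
    qed
    ultimately have "pm.dim ?F = card B" by (rule pm.dim_eq_card)
    then show ?thesis using injB img by (metis card_image dim_supported[OF S])
  qed
  have "k_basis N V (\<psi> ` ?e ` S)"
    unfolding k_basis_def
  proof (intro conjI ballI)
    have eF: "?e ` S \<subseteq> ?F" by auto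
    then show "\<psi> ` ?e ` S \<subseteq> V" using im by blast
    fix v assume "v \<in> V"
    then obtain g where g: "g \<in> ?F" "v = \<psi> g" using im by auto
    have inje: "inj_on ?e S" using inj_single_one by (rule inj_on_subset) simp
    \<comment> \<open>Injectivity of \<open>\<psi>\<close> turns an expansion of \<open>v\<close>
      into coordinate equations for \<open>g\<close>, so the only possible coefficients are read off
      from \<open>g\<close>.\<close>
    have eq: "(v = (\<Oplus>\<^bsub>N\<^esub>b\<in>\<psi> ` ?e ` S. ract N b (scalar (c b)))) \<longleftrightarrow>
        (\<forall>m\<in>S. c (\<psi> (?e m)) = Poly_Mapping.lookup g m)" for c
    proof -
      let ?s = "\<Sum>m\<in>S. pscale (c (\<psi> (?e m))) (?e m)"
      have s: "(\<Sum>b\<in>?e ` S. pscale (c (\<psi> b)) b) = ?s"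
        using inje by (simp add: sum.reindex)
      have "(v = (\<Oplus>\<^bsub>N\<^esub>b\<in>\<psi> ` ?e ` S. ract N b (scalar (c b)))) \<longleftrightarrow> g = ?s"
        using comb[OF _ eF, of c] S g inj unfolding s by (auto dest: inj_onD)
      also have "\<dots> \<longleftrightarrow> (\<forall>m\<in>S. c (\<psi> (?e m)) = Poly_Mapping.lookup g m)"
        using S g by (auto simp: poly_mapping_eq_iff fun_eq_iff sum_pscale_single in_keys_iff)
      finally show ?thesis .
    qed
    define c where "c = (\<lambda>y\<in>\<psi> ` ?e ` S. Poly_Mapping.lookup g (inv_into S (\<lambda>m. \<psi> (?e m)) y))"
    have inj2: "inj_on (\<lambda>m. \<psi> (?e m)) S"
      using comp_inj_on[OF inje inj_on_subset[OF inj eF]] by (simp add: o_def)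
    show "\<exists>!c. c \<in> \<psi> ` ?e ` S \<rightarrow>\<^sub>E UNIV \<and> v = (\<Oplus>\<^bsub>N\<^esub>b\<in>\<psi> ` ?e ` S. ract N b (scalar (c b)))"
      unfolding eq
    proof (rule ex1I[of _ c])
      show "c \<in> \<psi> ` ?e ` S \<rightarrow>\<^sub>E UNIV \<and> (\<forall>m\<in>S. c (\<psi> (?e m)) = Poly_Mapping.lookup g m)"
        using inv_into_f_f[OF inj2] by (auto simp: c_def)
      show "d = c" if d: "d \<in> \<psi> ` ?e ` S \<rightarrow>\<^sub>E UNIV \<and> (\<forall>m\<in>S. d (\<psi> (?e m)) = Poly_Mapping.lookup g m)" for d
      proof (rule PiE_ext)
        show "d \<in> \<psi> ` ?e ` S \<rightarrow>\<^sub>E UNIV" "c \<in> \<psi> ` ?e ` S \<rightarrow>\<^sub>E UNIV"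
          using that by (simp_all add: c_def)
        show "d y = c y" if "y \<in> \<psi> ` ?e ` S" for y
          using that d inv_into_f_f[OF inj2] by (auto simp: c_def)
      qed
    qed
  qed (use S in simp)
  with card show ?thesis
    unfolding k_dim_def by (intro the_equality) auto
qed

section \<open>Quotients of right modules\<close>

text \<open>These are the two properties of the action that let it descend to cosets.\<close>

locale right_module = abelian_group N for N :: "('v, 'a, 'd) graded_rmodule" (structure) +
  assumes ract_closed: "v \<in> carrier N \<Longrightarrow> ract N v a \<in> carrier N"
    and ract_add: "u \<in> carrier N \<Longrightarrow> v \<in> carrier N \<Longrightarrow> ract N (u \<oplus> v) a = ract N u a \<oplus> ract N v a"

text \<open>The additive monoid of a module record carries an extra record extension. The monoid
  laws do not see it, which lets the factor group of HOL-Algebra serve as the additive part of the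
  quotient.\<close>

lemma comm_monoid_extend:
  "comm_monoid \<lparr>carrier = C, mult = m, one = e\<rparr> \<Longrightarrow> comm_monoid \<lparr>carrier = C, mult = m, one = e, \<dots> = x\<rparr>"
  unfolding comm_monoid_def monoid_def comm_monoid_axioms_def
    partial_object.select_convs monoid.select_convs .

context right_module
begin

lemma quot_abelian_subgroup:
  assumes "right_submodule N M"
  shows "abelian_subgroup M N"
  using assms abelian_group_axioms by (intro abelian_subgroupI3) (auto simp: right_submodule_def)

lemma abelian_monoid_quot:
  assumes "right_submodule N M"
  shows "abelian_monoid (quot_rmodule N M)"
proof -
  interpret abelian_subgroup M N using assms by (rule quot_abelian_subgroup)
  have "comm_monoid (N A_Mod M)"
    using a_factorgroup_is_comm_group by (rule comm_group.axioms)
  then show ?thesis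
    by (intro abelian_monoid.intro)
      (simp add: quot_rmodule_def A_FactGroup_def' comm_monoid_extend)
qed

lemma carrier_quot: "carrier (quot_rmodule N M) = (\<lambda>v. M +> v) ` carrier N"
  by (auto simp: quot_rmodule_def A_RCOSETS_def')

lemma hcomp_quot: "hcomp (quot_rmodule N M) \<alpha> = (\<lambda>v. M +> v) ` hcomp N \<alpha>"
  by (simp add: quot_rmodule_def)

lemma add_quot:
  assumes "right_submodule N M" "u \<in> carrier N" "v \<in> carrier N"
  shows "(M +> u) \<oplus>\<^bsub>quot_rmodule N M\<^esub> (M +> v) = M +> (u \<oplus> v)"
proof -
  interpret abelian_subgroup M N using assms(1) by (rule quot_abelian_subgroup)
  show ?thesis using assms a_rcos_sum by (simp add: quot_rmodule_def)
qed

lemma coset_eqI: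
  assumes "right_submodule N M" "v \<in> carrier N" "u \<in> M +> v"
  shows "M +> u = M +> v"
proof -
  interpret abelian_subgroup M N using assms(1) by (rule quot_abelian_subgroup)
  show ?thesis using assms a_repr_independence[OF _ _ a_subgroup] by simp
qed

lemma coset_eq_iff:
  assumes "right_submodule N M" "u \<in> carrier N" "v \<in> carrier N"
  shows "M +> u = M +> v \<longleftrightarrow> u \<in> M +> v"
proof -
  interpret abelian_subgroup M N using assms(1) by (rule quot_abelian_subgroup)
  show ?thesis
    using coset_eqI[OF assms(1) assms(3), of u] a_rcos_self[OF assms(2)] by metis
qed

text \<open>Two representatives of a coset differ by some \<open>m\<close> in \<open>M\<close>, and
  \<open>m\<close> times \<open>a\<close> is again in \<open>M\<close>; so all cosets in the union
  that defines the action coincide.\<close>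

lemma ract_quot:
  assumes "right_submodule N M" "v \<in> carrier N"
  shows "ract (quot_rmodule N M) (M +> v) a = M +> ract N v a"
proof -
  interpret abelian_subgroup M N using assms(1) by (rule quot_abelian_subgroup)
  have "M +> ract N w a = M +> ract N v a" if w: "w \<in> M +> v" for w
  proof -
    obtain m where m: "m \<in> M" "w = m \<oplus> v" using w by (auto simp: a_r_coset_def')
    then have "ract N w a = ract N m a \<oplus> ract N v a" "ract N m a \<in> M"
      using assms a_subset ract_add by (auto simp: right_submodule_def)
    then show ?thesis
      using assms ract_closed by (intro coset_eqI) (auto simp: a_r_coset_def')
  qed
  then have "(\<Union>w\<in>M +> v. M +> ract N w a) = (\<Union>w\<in>M +> v. M +> ract N v a)" by (intro SUP_cong) auto
  also have "\<dots> = M +> ract N v a" using a_rcos_self[OF assms(2)] by blast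
  finally show ?thesis by (simp add: quot_rmodule_def)
qed

end

text \<open>The image of \<open>vec\<close> is a complement of \<open>M\<close> in degree
  \<open>\<alpha>\<close>: \<open>ex\<close> says that it spans modulo \<open>M\<close>,
  \<open>uniq\<close> that it meets \<open>M\<close> only in zero. Both the quotient by
  \<open>M\<close> and the quotients by monomial ideals are counted through this lemma.\<close>

lemma k_dim_quot:
  fixes N :: "('v, ('x, 'k::field) free_algebra, 'd) graded_rmodule" (structure)
    and vec :: "('m \<Rightarrow>\<^sub>0 'k) \<Rightarrow> 'v"
  assumes N: "right_module N" and M: "right_submodule N M" and S: "finite S"
    and hc: "hcomp N \<alpha> \<subseteq> carrier N"
    and mem: "\<And>g. Poly_Mapping.keys g \<subseteq> S \<Longrightarrow> vec g \<in> hcomp N \<alpha>"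
    and zero: "vec 0 = \<zero>"
    and add: "\<And>g h. Poly_Mapping.keys g \<subseteq> S \<Longrightarrow> Poly_Mapping.keys h \<subseteq> S \<Longrightarrow> vec (g + h) = vec g \<oplus> vec h"
    and scale: "\<And>c g. Poly_Mapping.keys g \<subseteq> S \<Longrightarrow> vec (pscale c g) = ract N (vec g) (scalar c)"
    and ex: "\<And>v. v \<in> hcomp N \<alpha> \<Longrightarrow> \<exists>g. Poly_Mapping.keys g \<subseteq> S \<and> v \<in> M +> vec g"
    and uniq: "\<And>g. Poly_Mapping.keys g \<subseteq> S \<Longrightarrow> vec g \<in> M \<Longrightarrow> g = 0"
  shows "k_dim (quot_rmodule N M) (hcomp (quot_rmodule N M) \<alpha>) = card S"
proof -
  interpret right_module N by fact
  interpret abelian_subgroup M N using M by (rule quot_abelian_subgroup)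
  have cl: "vec g \<in> carrier N" if "Poly_Mapping.keys g \<subseteq> S" for g
    using mem[OF that] hc by blast
  show ?thesis
  proof (rule k_dim_eq[OF abelian_monoid_quot[OF M] S, where \<psi> = "\<lambda>g. M +> vec g"])
    show "bij_betw (\<lambda>g. M +> vec g) {g. Poly_Mapping.keys g \<subseteq> S} (hcomp (quot_rmodule N M) \<alpha>)"
      unfolding bij_betw_def
    proof
      show "inj_on (\<lambda>g. M +> vec g) {g. Poly_Mapping.keys g \<subseteq> S}"
      proof (rule inj_onI, clarify)
        fix g h assume g: "Poly_Mapping.keys g \<subseteq> S" and h: "Poly_Mapping.keys h \<subseteq> S"
          and eq: "M +> vec g = M +> vec h"
        have d: "Poly_Mapping.keys (g - h) \<subseteq> S"
          using g h keys_diff[of g h] by blast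
        have "vec g \<in> M +> vec h" using eq coset_eq_iff[OF M cl[OF g] cl[OF h]] by simp
        then obtain m where m: "m \<in> M" "vec g = m \<oplus> vec h" by (auto simp: a_r_coset_def')
        \<comment> \<open>Only additivity of \<open>vec\<close> is available, so the difference of
          the two vectors is reached by cancelling \<open>vec h\<close>.\<close>
        have "vec g = vec (g - h) \<oplus> vec h" using add[OF d h] by simp
        with m(2) have "vec (g - h) \<oplus> vec h = m \<oplus> vec h" by (metis (no_types))
        then have "vec (g - h) = m"
          using add.right_cancel[OF cl[OF h] cl[OF d] subsetD[OF a_subset m(1)]] by simp
        then have "g - h = 0" using uniq[OF d] m(1) by simp
        then show "g = h" by simp
      qed
      show "(\<lambda>g. M +> vec g) ` {g. Poly_Mapping.keys g \<subseteq> S} = hcomp (quot_rmodule N M) \<alpha>"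
      proof -
        have "M +> v \<in> (\<lambda>g. M +> vec g) ` {g. Poly_Mapping.keys g \<subseteq> S}" if "v \<in> hcomp N \<alpha>" for v
        proof -
          obtain g where g: "Poly_Mapping.keys g \<subseteq> S" "v \<in> M +> vec g" using ex[OF \<open>v \<in> _\<close>] by auto
          have "M +> v = M +> vec g" by (rule coset_eqI[OF M cl[OF g(1)] g(2)])
          then show ?thesis using g(1) by blast
        qed
        then show ?thesis using mem by (auto simp: hcomp_quot)
      qed
    qed
    show "hcomp (quot_rmodule N M) \<alpha> \<subseteq> carrier (quot_rmodule N M)"
      using hc by (auto simp: hcomp_quot carrier_quot)
    show "M +> vec 0 = \<zero>\<^bsub>quot_rmodule N M\<^esub>"
      using zero a_subset by (simp add: quot_rmodule_def)
    show "M +> vec (g + h) = (M +> vec g) \<oplus>\<^bsub>quot_rmodule N M\<^esub> (M +> vec h)"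
      if "Poly_Mapping.keys g \<subseteq> S" "Poly_Mapping.keys h \<subseteq> S" for g h
      unfolding add[OF that] by (rule add_quot[OF M cl[OF that(1)] cl[OF that(2)], symmetric])
    show "M +> vec (pscale c g) = ract (quot_rmodule N M) (M +> vec g) (scalar c)"
      if "Poly_Mapping.keys g \<subseteq> S" for g c
      unfolding scale[OF that] by (rule ract_quot[OF M cl[OF that], symmetric])
  qed
qed

section \<open>Monomial right ideals\<close>

lemma poly_mapping_add_single_induct [case_names zero add]:
  fixes f :: "'a \<Rightarrow>\<^sub>0 'b::monoid_add"
  assumes "P 0"
    and "\<And>f a b. a \<notin> Poly_Mapping.keys f \<Longrightarrow> b \<noteq> 0 \<Longrightarrow> P f \<Longrightarrow> P (f + Poly_Mapping.single a b)"
  shows "P f"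
proof (induction f rule: update_induct)
  case (update f a b)
  have "Poly_Mapping.update a b f = f + Poly_Mapping.single a b"
    using update.hyps
    by (auto intro!: poly_mapping_eqI simp: lookup_update lookup_add lookup_single in_keys_iff)
  then show ?case using assms(2)[OF update.hyps update.IH] by simp
qed (rule assms)

lemma keys_add_single:
  fixes f :: "'a \<Rightarrow>\<^sub>0 'b::monoid_add"
  assumes "a \<notin> Poly_Mapping.keys f" "b \<noteq> 0"
  shows "Poly_Mapping.keys (f + Poly_Mapping.single a b) = insert a (Poly_Mapping.keys f)"
  using assms by (auto simp: in_keys_iff lookup_add lookup_single when_def split: if_splits)

text \<open>Right cancellation in the free monoid: \<open>u @ v\<close> determines \<open>u\<close>,
  so multiplying by one word never collects two terms.\<close>

lemma lookup_mult_single: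
  fixes f :: "'x list \<Rightarrow>\<^sub>0 'k::field"
  shows "Poly_Mapping.lookup (f * Poly_Mapping.single v c) (u @ v) = Poly_Mapping.lookup f u * c"
  by (induction f rule: poly_mapping_add_single_induct)
    (auto simp: distrib_right lookup_add mult_single lookup_single plus_list_def when_def)

lemma keys_mult_word:
  "Poly_Mapping.keys (f * word v :: 'x list \<Rightarrow>\<^sub>0 'k::field) = (\<lambda>u. u @ v) ` Poly_Mapping.keys f"
proof
  show "Poly_Mapping.keys (f * word v) \<subseteq> (\<lambda>u. u @ v) ` Poly_Mapping.keys f"
    using keys_mult[of f "word v"] by (auto simp: word_def plus_list_def)
  show "(\<lambda>u. u @ v) ` Poly_Mapping.keys f \<subseteq> Poly_Mapping.keys (f * word v)"
    by (auto simp: in_keys_iff word_def lookup_mult_single)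
qed

lemma lookup_mult_scalar [simp]: "Poly_Mapping.lookup (f * scalar c) w = Poly_Mapping.lookup f w * c"
  using lookup_mult_single[of f "[]" c w] by (simp add: scalar_def)

lemma mult_scalar: "f * scalar c = pscale c f"
  by (rule poly_mapping_eqI) simp

lemma keys_word [simp]: "Poly_Mapping.keys (word w :: 'x list \<Rightarrow>\<^sub>0 'k::field) = {w}"
  by (simp add: word_def)

lemma word_mult_scalar: "word w * scalar c = Poly_Mapping.single w c"
  by (rule poly_mapping_eqI) (simp add: word_def lookup_single when_def)

lemma word_mult_word: "word u * word v = (word (u @ v) :: 'x list \<Rightarrow>\<^sub>0 'k::field)"
  by (simp add: word_def mult_single plus_list_def)

text \<open>\<open>n\<close> stands for the ring element \<open>-1\<close>: with it, closure under
  the action yields closure under negatives.\<close>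

lemma (in right_module) right_submoduleI:
  assumes M: "M \<subseteq> carrier N" "\<zero> \<in> M" "\<And>u v. u \<in> M \<Longrightarrow> v \<in> M \<Longrightarrow> u \<oplus> v \<in> M"
    and ract: "\<And>v a. v \<in> M \<Longrightarrow> ract N v a \<in> M"
    and neg: "\<And>v. v \<in> M \<Longrightarrow> ract N v n \<oplus> v = \<zero>"
  shows "right_submodule N M"
proof -
  have "\<ominus> v \<in> M" if "v \<in> M" for v
    using minus_equality[OF neg[OF that] subsetD[OF M(1) that] subsetD[OF M(1) ract[OF that]]]
      ract[OF that] by simp
  then show ?thesis
    using M ract unfolding right_submodule_def
    by (auto intro!: additive_subgroupI add.subgroupI simp: a_inv_def)
qed

lemma (in right_module) right_submoduleD:
  assumes "right_submodule N M"
  shows "M \<subseteq> carrier N" "\<zero> \<in> M" "\<And>u v. u \<in> M \<Longrightarrow> v \<in> M \<Longrightarrow> u \<oplus> v \<in> M"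
    "\<And>v a. v \<in> M \<Longrightarrow> ract N v a \<in> M"
proof -
  interpret abelian_subgroup M N using assms by (rule quot_abelian_subgroup)
  show "M \<subseteq> carrier N" "\<zero> \<in> M" "\<And>u v. u \<in> M \<Longrightarrow> v \<in> M \<Longrightarrow> u \<oplus> v \<in> M"
    "\<And>v a. v \<in> M \<Longrightarrow> ract N v a \<in> M"
    using assms a_subset by (auto simp: right_submodule_def)
qed

section \<open>The modules F[-\<delta>] and F^r: explicit operations and submodule criteria\<close>

lemma shifted_simps [simp]:
  "carrier (shifted \<delta>) = UNIV" "\<zero>\<^bsub>shifted \<delta>\<^esub> = 0" "f \<oplus>\<^bsub>shifted \<delta>\<^esub> g = f + g"
  "ract (shifted \<delta>) f a = f * a"
  "hcomp (shifted \<delta>) \<alpha> = {f. \<forall>w\<in>Poly_Mapping.keys f. \<delta> + mdeg w = \<alpha>}"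
  by (simp_all add: shifted_def)

lemma free_module_simps [simp]:
  "carrier (free_module r \<delta>) = {1..r} \<rightarrow>\<^sub>E UNIV" "\<zero>\<^bsub>free_module r \<delta>\<^esub> = (\<lambda>i\<in>{1..r}. 0)"
  "u \<oplus>\<^bsub>free_module r \<delta>\<^esub> v = (\<lambda>i\<in>{1..r}. u i + v i)"
  "ract (free_module r \<delta>) v a = (\<lambda>i\<in>{1..r}. v i * a)"
  "hcomp (free_module r \<delta>) \<alpha> = (\<Pi>\<^sub>E i\<in>{1..r}. {f. \<forall>w\<in>Poly_Mapping.keys f. \<delta> i + mdeg w = \<alpha>})"
  by (simp_all add: free_module_def dsum_rmodule_def)

lemma right_module_shifted:
  "right_module (shifted \<delta> :: (('x, 'k::field) free_algebra, ('x, 'k) free_algebra, 'x multidegree) graded_rmodule)"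
proof (intro right_module.intro right_module_axioms.intro abelian_groupI)
  show "\<exists>y\<in>carrier (shifted \<delta>). y \<oplus>\<^bsub>shifted \<delta>\<^esub> x = \<zero>\<^bsub>shifted \<delta>\<^esub>" for x :: "'x list \<Rightarrow>\<^sub>0 'k::field"
    by (auto intro: exI[of _ "- x"])
qed (simp_all add: algebra_simps)

lemma right_module_free_module:
  "right_module (free_module r \<delta> :: (nat \<Rightarrow> ('x, 'k::field) free_algebra, ('x, 'k) free_algebra, 'x multidegree) graded_rmodule)"
proof (intro right_module.intro right_module_axioms.intro abelian_groupI)
  show "\<exists>y\<in>carrier (free_module r \<delta>). y \<oplus>\<^bsub>free_module r \<delta>\<^esub> x = \<zero>\<^bsub>free_module r \<delta>\<^esub>"
    for x :: "nat \<Rightarrow> 'x list \<Rightarrow>\<^sub>0 'k::field"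
    by (rule bexI[of _ "\<lambda>i\<in>{1..r}. - x i"]) (auto simp: fun_eq_iff)
qed (auto simp: algebra_simps restrict_PiE_iff fun_eq_iff PiE_def extensional_def)

lemma right_submodule_shifted_iff:
  fixes J :: "('x, 'k::field) free_algebra set"
  shows
  "right_submodule (shifted \<delta>) J \<longleftrightarrow>
    0 \<in> J \<and> (\<forall>f\<in>J. \<forall>g\<in>J. f + g \<in> J) \<and> (\<forall>f\<in>J. \<forall>a. f * a \<in> J)"
  (is "?L \<longleftrightarrow> ?R")
proof
  interpret right_module "shifted \<delta> :: (('x, 'k) free_algebra, ('x, 'k) free_algebra, 'x multidegree) graded_rmodule" by (rule right_module_shifted)
  show "?L \<Longrightarrow> ?R" using right_submoduleD[of J] by simp
  assume ?R
  then show ?L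
    by (intro right_submoduleI[where n = "-1"]) auto
qed

lemma right_submodule_free_module_iff:
  fixes M :: "(nat \<Rightarrow> ('x, 'k::field) free_algebra) set"
  shows
  "right_submodule (free_module r \<delta>) M \<longleftrightarrow>
    M \<subseteq> {1..r} \<rightarrow>\<^sub>E UNIV \<and> (\<lambda>i\<in>{1..r}. 0) \<in> M \<and> (\<forall>u\<in>M. \<forall>v\<in>M. (\<lambda>i\<in>{1..r}. u i + v i) \<in> M) \<and>
    (\<forall>v\<in>M. \<forall>a. (\<lambda>i\<in>{1..r}. v i * a) \<in> M)"
  (is "?L \<longleftrightarrow> ?R")
proof
  interpret right_module "free_module r \<delta> :: (nat \<Rightarrow> ('x, 'k) free_algebra, ('x, 'k) free_algebra, 'x multidegree) graded_rmodule" by (rule right_module_free_module)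
  show "?L \<Longrightarrow> ?R" using right_submoduleD[of M] by simp
  assume ?R
  then show ?L
    by (intro right_submoduleI[where n = "-1"]) (auto simp: fun_eq_iff)
qed

text \<open>With \<open>word_span\<close> this encodes a monomial right ideal by the set of words in
  it, so that questions about ideals become questions about sets of words.\<close>

definition right_closed :: "'x list set \<Rightarrow> bool"
  where "right_closed S \<longleftrightarrow> (\<forall>w\<in>S. \<forall>u. w @ u \<in> S)"

definition word_span :: "'x list set \<Rightarrow> ('x, 'k::field) free_algebra set"
  where "word_span S = {f. Poly_Mapping.keys f \<subseteq> S}"

lemma word_in_word_span [simp]: "word w \<in> word_span S \<longleftrightarrow> w \<in> S"
  by (simp add: word_span_def)

lemma right_submodule_word_span:
  fixes S :: "'x list set"
  assumes "right_closed S"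
  shows "right_submodule (shifted \<delta>) (word_span S :: ('x, 'k::field) free_algebra set)"
  unfolding right_submodule_shifted_iff word_span_def
proof (intro conjI ballI allI)
  fix f g a :: "('x, 'k) free_algebra"
  assume f: "f \<in> {f. Poly_Mapping.keys f \<subseteq> S}"
  then show "f * a \<in> {f. Poly_Mapping.keys f \<subseteq> S}"
    using keys_mult[of f a] assms unfolding right_closed_def plus_list_def by blast
  assume "g \<in> {f. Poly_Mapping.keys f \<subseteq> S}"
  with f show "f + g \<in> {f. Poly_Mapping.keys f \<subseteq> S}"
    using keys_add[of f g] by blast
qed simp

text \<open>Any submodule containing the words \<open>s\<close> contains each
  \<open>word s * word u * scalar b\<close>, and every element of the span is a finite sum of
  these.\<close>

lemma hull_words:
  "right_submodule (shifted \<delta>) hull (word ` S) =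
    (word_span {s @ u | s u. s \<in> S} :: ('x, 'k::field) free_algebra set)"
proof (rule hull_unique)
  let ?S = "{s @ u | s u. s \<in> S}"
  have "right_closed ?S" by (force simp: right_closed_def)
  then show "right_submodule (shifted \<delta>) (word_span ?S)" by (rule right_submodule_word_span)
  have "s \<in> ?S" if "s \<in> S" for s using that by (auto intro: exI[of _ "[]"])
  then show "word ` S \<subseteq> word_span ?S" by auto
  fix J :: "('x, 'k) free_algebra set"
  assume J: "word ` S \<subseteq> J" "right_submodule (shifted \<delta>) J"
  have "f \<in> J" if "Poly_Mapping.keys f \<subseteq> ?S" for f
    using that
  proof (induction f rule: poly_mapping_add_single_induct)
    case zero
    then show ?case using J(2) by (simp add: right_submodule_shifted_iff)
  next
    case (add f a b)
    then obtain s u where su: "a = s @ u" "s \<in> S" "f \<in> J" by (auto simp: keys_add_single)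
    then have "word s * word u * scalar b \<in> J"
      using J unfolding right_submodule_shifted_iff by blast
    then show ?case
      using J(2) su by (simp add: right_submodule_shifted_iff word_mult_word word_mult_scalar)
  qed
  then show "word_span ?S \<subseteq> J" by (auto simp: word_span_def)
qed

lemma monomial_right_ideals_eq:
  "(\<M>\<I> :: ('x, 'k::field) free_algebra set set) = {word_span S | S. right_closed S}"
proof -
  have c: "right_closed {s @ u | s u. s \<in> S}" for S :: "'x list set"
    by (force simp: right_closed_def)
  have e: "{s @ u | s u. s \<in> S} = S" if "right_closed S" for S :: "'x list set"
    using that by (force simp: right_closed_def intro: exI[of _ "[]"])
  show ?thesis
    unfolding monomial_right_ideals_def hull_words
  proof (intro subset_antisym subsetI)
    fix I :: "('x, 'k) free_algebra set"
    assume "I \<in> {word_span S | S. right_closed S}"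
    then obtain S where S: "I = word_span S" "right_closed S" by auto
    have "I = word_span {s @ u | s u. s \<in> S}" unfolding e[OF S(2)] by (rule S(1))
    then show "I \<in> {word_span {s @ u | s u. s \<in> S} | S. True}" by blast
  qed (use c in blast)
qed

section \<open>Normal forms\<close>

text \<open>A relational form of the leading monomial for coefficient functions; unlike
  \<open>lm\<close> it involves no definite description and is simply false for
  \<open>g = 0\<close>.\<close>

definition greatest_key :: "'m rel \<Rightarrow> ('m \<Rightarrow>\<^sub>0 'k::zero) \<Rightarrow> 'm \<Rightarrow> bool"
  where "greatest_key R g m \<longleftrightarrow> m \<in> Poly_Mapping.keys g \<and> (\<forall>m'\<in>Poly_Mapping.keys g. (m', m) \<in> R)"

lemma linear_order_on_finite_greatest:
  assumes "linear_order_on A R" "finite B" "B \<noteq> {}" "B \<subseteq> A"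
  shows "\<exists>m\<in>B. \<forall>m'\<in>B. (m', m) \<in> R"
  using assms(2-4)
proof (induction B rule: finite_ne_induct)
  case (singleton x)
  then show ?case using assms(1) by (auto simp: order_on_defs refl_on_def)
next
  case (insert x B)
  then obtain m where m: "m \<in> B" "\<forall>m'\<in>B. (m', m) \<in> R" by auto
  have x: "(x, x) \<in> R" using insert assms(1) by (auto simp: order_on_defs refl_on_def)
  show ?case
  proof (cases "(x, m) \<in> R")
    case True
    then show ?thesis using m by auto
  next
    case False
    have "x \<in> A" "m \<in> A" "x \<noteq> m" using insert m by auto
    then have "(m, x) \<in> R"
      using False assms(1) unfolding order_on_defs total_on_def by blast
    then have "\<forall>m'\<in>B. (m', x) \<in> R"
      using m assms(1) unfolding order_on_defs by (blast dest: transD)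
    then show ?thesis using x by auto
  qed
qed

lemma greatest_key_exists:
  assumes "well_order_on A R" "Poly_Mapping.keys g \<subseteq> A" "g \<noteq> 0"
  shows "\<exists>m. greatest_key R g m"
  using linear_order_on_finite_greatest[of A R "Poly_Mapping.keys g"] assms
  by (auto simp: greatest_key_def well_order_on_def)

lemma greatest_key_unique:
  assumes "well_order_on A R" "greatest_key R g m" "greatest_key R g m'"
  shows "m = m'"
  using assms by (auto simp: greatest_key_def order_on_defs dest: antisymD)

text \<open>Well-founded induction on the greatest key \<open>m\<close> of \<open>g\<close>. If
  \<open>m\<close> is a leading monomial, a multiple of an element of \<open>M\<close> removes it;
  otherwise its term is moved into \<open>u\<close>. Either way only smaller monomials
  remain.\<close>

lemma normal_form_exists:
  fixes M :: "('m \<Rightarrow>\<^sub>0 'k::field) set"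
  assumes R: "well_order_on A R" and M: "pm.subspace M" and "Poly_Mapping.keys g \<subseteq> A"
  shows "\<exists>u. Poly_Mapping.keys u \<subseteq> A - {m. \<exists>f\<in>M. greatest_key R f m} \<and> g - u \<in> M"
proof -
  let ?L = "{m. \<exists>f\<in>M. greatest_key R f m}"
  have wf: "wf (R - Id)" using R by (simp add: well_order_on_def)
  have RA: "R \<subseteq> A \<times> A" using R by (auto simp: order_on_defs)
  have main: "\<exists>u. Poly_Mapping.keys u \<subseteq> A - ?L \<and> g - u \<in> M"
    if "greatest_key R g m" "Poly_Mapping.keys g \<subseteq> A" for g m
    using wf that
  proof (induction m arbitrary: g rule: wf_induct_rule)
    case (less m)
    let ?a = "Poly_Mapping.lookup g m"
    \<comment> \<open>\<open>h\<close> is anything with the same leading term as \<open>g\<close>: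
      then \<open>g - h\<close> is zero or has a strictly smaller greatest key, and the induction
      hypothesis applies to it.\<close>
    have reduce: "\<exists>u. Poly_Mapping.keys u \<subseteq> A - ?L \<and> g - h - u \<in> M"
      if h: "greatest_key R h m" "Poly_Mapping.lookup h m = ?a" "Poly_Mapping.keys h \<subseteq> A" for h
    proof (cases "g - h = 0")
      case True
      then show ?thesis using pm.subspace_0[OF M] by (intro exI[of _ 0]) simp
    next
      case False
      have gh: "Poly_Mapping.keys (g - h) \<subseteq> A" using keys_diff[of g h] h less.prems by blast
      then obtain n where n: "greatest_key R (g - h) n"
        using greatest_key_exists[OF R _ False] by blast
      then have n': "n \<in> Poly_Mapping.keys (g - h)" by (simp add: greatest_key_def)
      have "(n, m) \<in> R"
        using n' keys_diff[of g h] h(1) less.prems(1) unfolding greatest_key_def by blast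
      moreover have "n \<noteq> m" using n' h(2) by (auto simp: in_keys_iff lookup_minus)
      ultimately show ?thesis using less.IH[OF _ n gh] by simp
    qed
    show ?case
    proof (cases "m \<in> ?L")
      case True
      then obtain f where f: "f \<in> M" "greatest_key R f m" by blast
      let ?c = "?a / Poly_Mapping.lookup f m"
      have a: "?a \<noteq> 0" "Poly_Mapping.lookup f m \<noteq> 0"
        using f less.prems by (auto simp: greatest_key_def in_keys_iff)
      then have "greatest_key R (pscale ?c f) m" "Poly_Mapping.lookup (pscale ?c f) m = ?a"
        using f by (auto simp: greatest_key_def in_keys_iff)
      moreover have "Poly_Mapping.keys (pscale ?c f) \<subseteq> A"
      proof -
        have "Poly_Mapping.keys f \<subseteq> A"
          using f(2) RA by (auto simp: greatest_key_def)
        then show ?thesis by (rule subset_trans[OF keys_pscale_subset])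
      qed
      ultimately obtain u where u: "Poly_Mapping.keys u \<subseteq> A - ?L" "g - pscale ?c f - u \<in> M"
        using reduce by blast
      have "(g - pscale ?c f - u) + pscale ?c f \<in> M"
        using M f(1) u(2) by (intro pm.subspace_add pm.subspace_scale)
      then have "g - u \<in> M" by simp
      then show ?thesis using u(1) by blast
    next
      case False
      have a: "?a \<noteq> 0" "m \<in> A" "(m, m) \<in> R" using less.prems by (auto simp: greatest_key_def in_keys_iff)
      \<comment> \<open>The term at \<open>m\<close> is already normal: it is split off for the
        induction and added back to the normal form.\<close>
      let ?h = "Poly_Mapping.single m ?a"
      have "greatest_key R ?h m" "Poly_Mapping.lookup ?h m = ?a" "Poly_Mapping.keys ?h \<subseteq> A"
        using a by (auto simp: greatest_key_def)
      then obtain u where u: "Poly_Mapping.keys u \<subseteq> A - ?L" "g - ?h - u \<in> M"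
        using reduce by blast
      have "Poly_Mapping.keys (?h + u) \<subseteq> A - ?L"
        using u(1) a(1,2) False by (intro order_trans[OF keys_add]) simp
      moreover have "g - (?h + u) \<in> M" using u(2) by (simp add: diff_diff_eq)
      ultimately show ?thesis by blast
    qed
  qed
  show ?thesis
  proof (cases "g = 0")
    case True
    then show ?thesis using pm.subspace_0[OF M] by (intro exI[of _ 0]) simp
  next
    case False
    then show ?thesis using greatest_key_exists[OF R assms(3)] main assms(3) by blast
  qed
qed

text \<open>A nonzero \<open>u\<close> would have a greatest key, which lies in the excluded set
  because \<open>u\<close> is in \<open>M\<close>.\<close>

lemma normal_form_zero:
  assumes "well_order_on A R" "u \<in> M" "Poly_Mapping.keys u \<subseteq> A - {m. \<exists>f\<in>M. greatest_key R f m}"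
  shows "u = 0"
  using greatest_key_exists[of A R u] assms by (force simp: greatest_key_def)

text \<open>With \<open>P\<close> the property of having degree \<open>\<alpha>\<close>, this is the
  projection onto a homogeneous component.\<close>

definition pm_filter :: "('m \<Rightarrow> bool) \<Rightarrow> ('m \<Rightarrow>\<^sub>0 'k::zero) \<Rightarrow> 'm \<Rightarrow>\<^sub>0 'k"
  where "pm_filter P g = Abs_poly_mapping (\<lambda>m. if P m then Poly_Mapping.lookup g m else 0)"

lemma lookup_pm_filter [simp]:
  "Poly_Mapping.lookup (pm_filter P g) m = (if P m then Poly_Mapping.lookup g m else 0)"
proof -
  have "finite {m. (if P m then Poly_Mapping.lookup g m else 0) \<noteq> 0}"
    by (rule finite_subset[OF _ finite_keys[of g]]) (auto simp: in_keys_iff split: if_splits)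
  then show ?thesis unfolding pm_filter_def by (subst lookup_Abs_poly_mapping) auto
qed

lemma keys_pm_filter [simp]: "Poly_Mapping.keys (pm_filter P g) = {m \<in> Poly_Mapping.keys g. P m}"
  by (auto simp: in_keys_iff split: if_splits)

text \<open>The projection fixes \<open>g\<close> and keeps \<open>g - u\<close> in
  \<open>M\<close>, so it may be applied to the part \<open>u\<close> that reduction
  produced.\<close>

lemma homogeneous_normal_form_exists:
  fixes M :: "('m \<Rightarrow>\<^sub>0 'k::field) set"
  assumes "well_order_on A R" "pm.subspace M" "Poly_Mapping.keys g \<subseteq> {m \<in> A. P m}"
    and filter: "\<And>g. g \<in> M \<Longrightarrow> pm_filter P g \<in> M"
  shows "\<exists>u. Poly_Mapping.keys u \<subseteq> {m \<in> A - {m. \<exists>f\<in>M. greatest_key R f m}. P m} \<and> g - u \<in> M"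
proof -
  obtain u where u: "Poly_Mapping.keys u \<subseteq> A - {m. \<exists>f\<in>M. greatest_key R f m}" "g - u \<in> M"
    using normal_form_exists[OF assms(1,2), of g] assms(3) by blast
  have "pm_filter P (g - u) = g - pm_filter P u"
    using assms(3) by (intro poly_mapping_eqI) (auto simp: lookup_minus in_keys_iff)
  then have "g - pm_filter P u \<in> M" using filter[OF u(2)] by simp
  then show ?thesis using u(1) by (intro exI[of _ "pm_filter P u"]) auto
qed

section \<open>Multidegrees and the Hilbert series of a monomial quotient\<close>

lemma lookup_mdeg: "Poly_Mapping.lookup (mdeg w) x = count_list w x"
  by (induction w) (auto simp: mdeg_def lookup_add lookup_single)

lemma mdeg_Nil [simp]: "mdeg [] = 0" and mdeg_Cons: "mdeg (x # w) = Poly_Mapping.single x 1 + mdeg w"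
  by (simp_all add: mdeg_def)

text \<open>The multidegree fixes the length of a word, and the alphabet is finite.\<close>

lemma finite_mdeg_eq: "finite {w :: 'x::finite list. \<delta> + mdeg w = \<alpha>}"
proof (rule finite_subset)
  show "{w. \<delta> + mdeg w = \<alpha>} \<subseteq>
      {w :: 'x list. set w \<subseteq> UNIV \<and> length w = (\<Sum>x\<in>UNIV. Poly_Mapping.lookup (\<alpha> - \<delta>) x)}"
  proof clarsimp
    fix w :: "'x list"
    have "length w = (\<Sum>x\<in>UNIV. Poly_Mapping.lookup (mdeg w) x)"
      unfolding lookup_mdeg
      using sum.mono_neutral_left[of "UNIV :: 'x set" "set w" "count_list w"]
      by (simp add: sum_count_set)
    then show "length w = (\<Sum>x\<in>UNIV. Poly_Mapping.lookup (mdeg w) x)" .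
  qed
qed (rule finite_lists_length_eq, simp)

text \<open>For a monomial ideal no reduction is required: deleting the terms of \<open>v\<close>
  with words in \<open>S\<close> gives its normal form.\<close>

lemma HS_word_span:
  fixes S :: "'x::finite list set"
  assumes S: "right_closed S"
  shows "HS (quot_rmodule (shifted \<delta>) (word_span S :: ('x, 'k::field) free_algebra set)) \<alpha> =
    int (card {w. w \<notin> S \<and> \<delta> + mdeg w = \<alpha>})"
proof -
  let ?N = "shifted \<delta> :: (('x, 'k) free_algebra, ('x, 'k) free_algebra, 'x multidegree) graded_rmodule"
  let ?S = "{w. w \<notin> S \<and> \<delta> + mdeg w = \<alpha>}"
  have "k_dim (quot_rmodule ?N (word_span S)) (hcomp (quot_rmodule ?N (word_span S)) \<alpha>) = card ?S"
  proof (rule k_dim_quot[where vec = "\<lambda>g. g", OF right_module_shifted right_submodule_word_span[OF S]])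
    show "finite ?S" by (rule finite_subset[OF _ finite_mdeg_eq[of \<delta> \<alpha>]]) auto
    show "\<exists>g. Poly_Mapping.keys g \<subseteq> ?S \<and> v \<in> word_span S +>\<^bsub>?N\<^esub> g" if "v \<in> hcomp ?N \<alpha>" for v
    proof (intro exI conjI)
      let ?g = "pm_filter (\<lambda>w. w \<notin> S) v"
      show "Poly_Mapping.keys ?g \<subseteq> ?S" using that by auto
      have "v - ?g \<in> word_span S"
        by (auto simp: word_span_def in_keys_iff lookup_minus split: if_splits)
      then show "v \<in> word_span S +>\<^bsub>?N\<^esub> ?g"
        by (auto simp: a_r_coset_def' intro!: bexI[of _ "v - ?g"])
    qed
    show "g = 0" if "Poly_Mapping.keys g \<subseteq> ?S" "g \<in> word_span S" for g :: "('x, 'k) free_algebra"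
    proof -
      have "Poly_Mapping.keys g = {}" using that unfolding word_span_def by blast
      then show ?thesis by simp
    qed
  qed (auto simp: mult_scalar)
  then show ?thesis by (simp add: HS_def)
qed

section \<open>Leading monomials of a submodule\<close>

definition mon_deg :: "(nat \<Rightarrow> 'x multidegree) \<Rightarrow> nat \<times> 'x list \<Rightarrow> 'x multidegree"
  where "mon_deg \<delta> m = \<delta> (fst m) + mdeg (snd m)"

text \<open>
  Coordinates of \<open>F\<^sup>r\<close> with respect to its monomials; reduction is carried out on them because
  families in \<open>{1..r} \<rightarrow>\<^sub>E UNIV\<close> do not form a type.
\<close>

definition to_vec :: "nat \<Rightarrow> (nat \<times> 'x list \<Rightarrow>\<^sub>0 'k::field) \<Rightarrow> nat \<Rightarrow> ('x, 'k) free_algebra"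
  where "to_vec r g = (\<lambda>i\<in>{1..r}. Poly_Mapping.map_key (Pair i) g)"

definition of_vec :: "nat \<Rightarrow> (nat \<Rightarrow> ('x, 'k::field) free_algebra) \<Rightarrow> nat \<times> 'x list \<Rightarrow>\<^sub>0 'k"
  where "of_vec r v = Abs_poly_mapping (\<lambda>(i, w). if i \<in> {1..r} then Poly_Mapping.lookup (v i) w else 0)"

lemma lookup_to_vec: "i \<in> {1..r} \<Longrightarrow> Poly_Mapping.lookup (to_vec r g i) w = Poly_Mapping.lookup g (i, w)"
  by (simp add: to_vec_def map_key.rep_eq inj_def)

lemma to_vec_in_carrier: "to_vec r g \<in> {1..r} \<rightarrow>\<^sub>E UNIV"
  by (simp add: to_vec_def)

lemma vec_eqI:
  assumes "u \<in> {1..r} \<rightarrow>\<^sub>E UNIV" "v \<in> {1..r} \<rightarrow>\<^sub>E UNIV"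
    and "\<And>i w. i \<in> {1..r} \<Longrightarrow> Poly_Mapping.lookup (u i) w = Poly_Mapping.lookup (v i) w"
  shows "u = v"
  by (rule PiE_ext[OF assms(1,2)]) (auto intro!: poly_mapping_eqI assms(3))

lemma lookup_of_vec:
  "Poly_Mapping.lookup (of_vec r v) (i, w) = (if i \<in> {1..r} then Poly_Mapping.lookup (v i) w else 0)"
proof -
  have "finite {m. (case m of (i, w) \<Rightarrow> if i \<in> {1..r} then Poly_Mapping.lookup (v i) w else 0) \<noteq> 0}"
    by (rule finite_subset[of _ "SIGMA i:{1..r}. Poly_Mapping.keys (v i)"])
      (auto simp: in_keys_iff split: if_splits)
  then show ?thesis unfolding of_vec_def by (subst lookup_Abs_poly_mapping) auto
qed

lemma keys_of_vec: "Poly_Mapping.keys (of_vec r v) = occurring r v"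
  by (auto simp: occurring_def in_keys_iff lookup_of_vec split: if_splits)

lemma occurring_subset: "occurring r v \<subseteq> monomials r"
  by (auto simp: occurring_def monomials_def)

lemma to_vec_of_vec:
  assumes "v \<in> {1..r} \<rightarrow>\<^sub>E UNIV"
  shows "to_vec r (of_vec r v) = v"
  by (rule vec_eqI[OF to_vec_in_carrier assms]) (simp add: lookup_to_vec lookup_of_vec)

lemma of_vec_to_vec:
  assumes "Poly_Mapping.keys g \<subseteq> monomials r"
  shows "of_vec r (to_vec r g) = g"
proof (rule poly_mapping_eqI)
  fix m :: "nat \<times> 'a list"
  show "Poly_Mapping.lookup (of_vec r (to_vec r g)) m = Poly_Mapping.lookup g m"
    using assms by (cases m) (auto simp: lookup_of_vec lookup_to_vec in_keys_iff monomials_def)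
qed

lemma to_vec_zero: "to_vec r 0 = (\<lambda>i\<in>{1..r}. 0)"
  by (rule vec_eqI[OF to_vec_in_carrier]) (simp_all add: lookup_to_vec)

lemma to_vec_add: "to_vec r (g + h) = (\<lambda>i\<in>{1..r}. to_vec r g i + to_vec r h i)"
  by (rule vec_eqI[OF to_vec_in_carrier]) (simp_all add: lookup_to_vec lookup_add)

lemma to_vec_pscale: "to_vec r (pscale c g) = (\<lambda>i\<in>{1..r}. to_vec r g i * scalar c)"
  by (rule vec_eqI[OF to_vec_in_carrier]) (simp_all add: lookup_to_vec)

lemma to_vec_single:
  "to_vec r (Poly_Mapping.single m c) = (\<lambda>i\<in>{1..r}. mon_vec r m i * scalar c)"
proof (rule vec_eqI[OF to_vec_in_carrier])
  fix i w assume "i \<in> {1..r}"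
  then show "Poly_Mapping.lookup (to_vec r (Poly_Mapping.single m c) i) w =
      Poly_Mapping.lookup ((\<lambda>i\<in>{1..r}. mon_vec r m i * scalar c) i) w"
    by (cases m) (auto simp: lookup_to_vec mon_vec_def word_def lookup_single when_def)
qed simp

lemma occurring_mon_vec:
  assumes "m \<in> monomials r"
  shows "occurring r (mon_vec r m :: nat \<Rightarrow> ('x, 'k::field) free_algebra) = {m}"
  using assms by (cases m) (auto simp: occurring_def mon_vec_def monomials_def split: if_splits)

lemma lm_eqI:
  assumes "well_order_on (monomials r) R" "greatest_key R (of_vec r f) m"
  shows "lm r R f = m"
  unfolding lm_def
proof (rule the_equality)
  show "m \<in> occurring r f \<and> (\<forall>m'\<in>occurring r f. (m', m) \<in> R)"
    using assms(2) by (simp add: greatest_key_def keys_of_vec)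
  show "n = m" if "n \<in> occurring r f \<and> (\<forall>m'\<in>occurring r f. (m', n) \<in> R)" for n
    using greatest_key_unique[OF assms(1) _ assms(2), of n] that by (simp add: greatest_key_def keys_of_vec)
qed

lemma finsum_free_module:
  fixes h :: "'i \<Rightarrow> nat \<Rightarrow> ('x, 'k::field) free_algebra"
  assumes "finite D" "\<And>\<beta>. \<beta> \<in> D \<Longrightarrow> h \<beta> \<in> {1..r} \<rightarrow>\<^sub>E UNIV"
  shows "(\<Oplus>\<^bsub>free_module r \<delta>\<^esub>\<beta>\<in>D. h \<beta>) = (\<lambda>i\<in>{1..r}. \<Sum>\<beta>\<in>D. h \<beta> i)"
  using assms
proof (induction D)
  interpret right_module "free_module r \<delta> :: (nat \<Rightarrow> ('x, 'k) free_algebra, ('x, 'k) free_algebra, 'x multidegree) graded_rmodule"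
    by (rule right_module_free_module)
  {
    case empty
    show ?case by simp
  next
    case (insert \<beta> D)
    then have "(\<Oplus>\<^bsub>free_module r \<delta>\<^esub>\<beta>\<in>insert \<beta> D. h \<beta>) = h \<beta> \<oplus>\<^bsub>free_module r \<delta>\<^esub> (\<Oplus>\<^bsub>free_module r \<delta>\<^esub>\<beta>\<in>D. h \<beta>)"
      by (intro finsum_insert) auto
    then show ?case using insert by (simp add: fun_eq_iff)
  }
qed

locale leading_monomials =
  fixes r :: nat and \<delta> :: "nat \<Rightarrow> 'x::finite multidegree"
    and M :: "(nat \<Rightarrow> ('x, 'k::field) free_algebra) set" and R :: "(nat \<times> 'x list) rel"
  assumes submodule: "right_submodule (free_module r \<delta>) M"
    and graded: "multigraded (free_module r \<delta>) M"
    and ordering: "monomial_ordering r R"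
begin

abbreviation FM where
  "FM \<equiv> free_module r \<delta> :: (nat \<Rightarrow> ('x, 'k) free_algebra, ('x, 'k) free_algebra, 'x multidegree) graded_rmodule"

text \<open>\<open>to_vec\<close> forgets all coordinates outside \<open>{1..r}\<close>; the bound
  on the keys makes it injective here.\<close>

definition coeffs :: "(nat \<times> 'x list \<Rightarrow>\<^sub>0 'k) set"
  where "coeffs = {g. Poly_Mapping.keys g \<subseteq> monomials r \<and> to_vec r g \<in> M}"

text \<open>The set \<open>L\<close>, phrased with greatest keys so that the reduction lemmas apply;
  \<open>leading_eq\<close> identifies it with the values of \<open>lm\<close>.\<close>

definition leading :: "(nat \<times> 'x list) set"
  where "leading = {m. \<exists>g\<in>coeffs. greatest_key R g m}"

lemma wo: "well_order_on (monomials r) R"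
  using ordering by (simp add: monomial_ordering_def)

lemma M_carrier: "v \<in> M \<Longrightarrow> v \<in> {1..r} \<rightarrow>\<^sub>E UNIV"
  using submodule unfolding right_submodule_free_module_iff by blast

lemma of_vec_coeffs: "v \<in> M \<Longrightarrow> of_vec r v \<in> coeffs"
  by (simp add: coeffs_def keys_of_vec occurring_subset to_vec_of_vec[OF M_carrier])

lemma subspace_coeffs: "pm.subspace coeffs"
proof (rule pm.subspaceI)
  show "0 \<in> coeffs"
    using submodule by (simp add: coeffs_def to_vec_zero right_submodule_free_module_iff)
  show "g + h \<in> coeffs" if "g \<in> coeffs" "h \<in> coeffs" for g h
    using that submodule order_trans[OF keys_add[of g h]]
    by (auto simp: coeffs_def to_vec_add right_submodule_free_module_iff)
  show "pscale c g \<in> coeffs" if "g \<in> coeffs" for c g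
    using that submodule order_trans[OF keys_pscale_subset[of c g]]
    by (auto simp: coeffs_def to_vec_pscale right_submodule_free_module_iff)
qed

text \<open>This is where the grading of \<open>M\<close> enters: an element of \<open>M\<close> is
  a finite sum of homogeneous elements \<open>h \<beta>\<close> of \<open>M\<close>, and its part of
  degree \<open>\<alpha>\<close> is one of these summands.\<close>

lemma filter_coeffs:
  assumes "g \<in> coeffs"
  shows "pm_filter (\<lambda>m. mon_deg \<delta> m = \<alpha>) g \<in> coeffs"
proof -
  have "to_vec r g \<in> M" using assms by (simp add: coeffs_def)
  from subsetD[OF equalityD1[OF graded[unfolded multigraded_def]] this]
  have "\<exists>D h. to_vec r g = (\<Oplus>\<^bsub>FM\<^esub>\<beta>\<in>D. h \<beta>) \<and> finite D \<and> (\<forall>\<beta>\<in>D. h \<beta> \<in> M \<inter> hcomp FM \<beta>)"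
    by (simp only: mem_Collect_eq)
  then obtain D h where eq: "to_vec r g = (\<Oplus>\<^bsub>FM\<^esub>\<beta>\<in>D. h \<beta>)" and "finite D"
      and "\<forall>\<beta>\<in>D. h \<beta> \<in> M \<inter> hcomp FM \<beta>"
    by blast
  note D = \<open>finite D\<close> bspec[OF this(3)]
  have sum: "to_vec r g = (\<lambda>i\<in>{1..r}. \<Sum>\<beta>\<in>D. h \<beta> i)"
    unfolding eq using D M_carrier by (intro finsum_free_module) auto
  have lk: "Poly_Mapping.lookup (h \<beta> i) w = 0" if "\<beta> \<in> D" "i \<in> {1..r}" "mon_deg \<delta> (i, w) \<noteq> \<beta>" for \<beta> i w
  proof -
    have "w \<notin> Poly_Mapping.keys (h \<beta> i)"
      using D(2)[OF that(1)] that(2,3) by (auto simp: mon_deg_def PiE_iff)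
    then show ?thesis by (simp add: in_keys_iff)
  qed
  \<comment> \<open>If \<open>\<alpha>\<close> is not among the degrees in \<open>D\<close>, the
    projection is the zero vector, which also lies in \<open>M\<close>.\<close>
  have "to_vec r (pm_filter (\<lambda>m. mon_deg \<delta> m = \<alpha>) g) = (if \<alpha> \<in> D then h \<alpha> else (\<lambda>i\<in>{1..r}. 0))"
    (is "_ = ?v")
  proof (rule vec_eqI[OF to_vec_in_carrier])
    show "?v \<in> {1..r} \<rightarrow>\<^sub>E UNIV" using D(2) M_carrier by auto
    fix i w assume i: "i \<in> {1..r}"
    have "Poly_Mapping.lookup g (i, w) = Poly_Mapping.lookup (to_vec r g i) w"
      using i by (simp add: lookup_to_vec)
    also have "\<dots> = (\<Sum>\<beta>\<in>D. Poly_Mapping.lookup (h \<beta> i) w)"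
      using i by (simp add: sum lookup_sum)
    also have "\<dots> = (\<Sum>\<beta>\<in>D. if \<beta> = mon_deg \<delta> (i, w) then Poly_Mapping.lookup (h \<beta> i) w else 0)"
      using lk i by (intro sum.cong) auto
    also have "\<dots> = (if mon_deg \<delta> (i, w) \<in> D then Poly_Mapping.lookup (h (mon_deg \<delta> (i, w)) i) w else 0)"
      using D(1) by simp
    finally show "Poly_Mapping.lookup (to_vec r (pm_filter (\<lambda>m. mon_deg \<delta> m = \<alpha>) g) i) w = Poly_Mapping.lookup (?v i) w"
      using i lk[of \<alpha> i w] by (auto simp: lookup_to_vec)
  qed
  moreover have "?v \<in> M" using D(2) submodule by (simp add: right_submodule_free_module_iff)
  ultimately show ?thesis using assms by (auto simp: coeffs_def)
qed

text \<open>Spanning modulo \<open>M\<close> comes from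
  \<open>homogeneous_normal_form_exists\<close>, independence from
  \<open>normal_form_zero\<close>.\<close>

lemma HS_quot:
  "HS (quot_rmodule FM M) \<alpha> = int (card {m \<in> monomials r - leading. mon_deg \<delta> m = \<alpha>})"
proof -
  let ?S = "{m \<in> monomials r - leading. mon_deg \<delta> m = \<alpha>}"
  have mem: "to_vec r g \<in> hcomp FM \<alpha>" if "Poly_Mapping.keys g \<subseteq> ?S" for g
  proof -
    have "\<forall>w\<in>Poly_Mapping.keys (to_vec r g i). \<delta> i + mdeg w = \<alpha>" if "i \<in> {1..r}" for i
      using \<open>Poly_Mapping.keys g \<subseteq> ?S\<close> that by (force simp: in_keys_iff lookup_to_vec mon_deg_def)
    then show ?thesis by (simp add: PiE_iff to_vec_def)
  qed
  have "k_dim (quot_rmodule FM M) (hcomp (quot_rmodule FM M) \<alpha>) = card ?S"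
  proof (rule k_dim_quot[where vec = "to_vec r", OF right_module_free_module submodule])
    show "finite ?S"
    proof (rule finite_subset)
      show "?S \<subseteq> (SIGMA i:{1..r}. {w. \<delta> i + mdeg w = \<alpha>})"
        by (auto simp: monomials_def mon_deg_def)
    qed (intro finite_SigmaI finite_mdeg_eq, simp)
    show "hcomp FM \<alpha> \<subseteq> carrier FM" by (auto simp: PiE_iff)
    show "\<exists>g. Poly_Mapping.keys g \<subseteq> ?S \<and> v \<in> M +>\<^bsub>FM\<^esub> to_vec r g" if v: "v \<in> hcomp FM \<alpha>" for v
    proof -
      have c: "v \<in> {1..r} \<rightarrow>\<^sub>E UNIV" using v by (auto simp: PiE_iff)
      have "occurring r v \<subseteq> {m \<in> monomials r. mon_deg \<delta> m = \<alpha>}"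
        using v by (auto simp: PiE_iff occurring_def monomials_def mon_deg_def)
      then obtain u where u: "Poly_Mapping.keys u \<subseteq> ?S" "of_vec r v - u \<in> coeffs"
        using homogeneous_normal_form_exists[OF wo subspace_coeffs, of "of_vec r v" "\<lambda>m. mon_deg \<delta> m = \<alpha>"]
          filter_coeffs unfolding keys_of_vec leading_def by blast
      have "v = to_vec r ((of_vec r v - u) + u)" using c by (simp add: to_vec_of_vec)
      also have "\<dots> = to_vec r (of_vec r v - u) \<oplus>\<^bsub>FM\<^esub> to_vec r u" unfolding to_vec_add by simp
      finally have "v \<in> M +>\<^bsub>FM\<^esub> to_vec r u"
        using u(2) unfolding a_r_coset_def' coeffs_def by blast
      then show ?thesis using u(1) by blast
    qed
    show "g = 0" if "Poly_Mapping.keys g \<subseteq> ?S" "to_vec r g \<in> M" for g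
    proof (rule normal_form_zero[OF wo])
      show "g \<in> coeffs" using that by (auto simp: coeffs_def)
      show "Poly_Mapping.keys g \<subseteq> monomials r - {m. \<exists>f\<in>coeffs. greatest_key R f m}"
        using that(1) by (auto simp: leading_def)
    qed
  qed (use mem in \<open>simp_all add: to_vec_zero to_vec_add to_vec_pscale\<close>)
  then show ?thesis by (simp add: HS_def)
qed

lemma leading_subset: "leading \<subseteq> monomials r"
  by (auto simp: leading_def coeffs_def greatest_key_def)

text \<open>Multiply an element with leading monomial \<open>(i, u)\<close> by \<open>w\<close>: no
  terms cancel, and compatibility of the ordering keeps the image of the greatest monomial
  greatest.\<close>

lemma leading_right_closed:
  assumes "(i, u) \<in> leading"
  shows "(i, u @ w) \<in> leading"
proof -
  obtain g where g: "Poly_Mapping.keys g \<subseteq> monomials r" "to_vec r g \<in> M" "greatest_key R g (i, u)"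
    using assms by (auto simp: leading_def coeffs_def)
  define f where "f = (\<lambda>i\<in>{1..r}. to_vec r g i * word w)"
  have f: "f \<in> M" using g submodule by (simp add: f_def right_submodule_free_module_iff)
  have occ: "occurring r (to_vec r g) = Poly_Mapping.keys g"
    using of_vec_to_vec[OF g(1)] keys_of_vec by metis
  have "occurring r f = (\<lambda>(i, u). (i, u @ w)) ` occurring r (to_vec r g)"
    by (auto simp: occurring_def f_def keys_mult_word image_def)
  then have k: "Poly_Mapping.keys (of_vec r f) = (\<lambda>(i, u). (i, u @ w)) ` Poly_Mapping.keys g"
    by (simp add: occ keys_of_vec)
  have "greatest_key R (of_vec r f) (i, u @ w)"
    unfolding greatest_key_def
  proof
    show m: "(i, u @ w) \<in> Poly_Mapping.keys (of_vec r f)"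
      using g(3) unfolding k greatest_key_def by force
    show "\<forall>m'\<in>Poly_Mapping.keys (of_vec r f). (m', (i, u @ w)) \<in> R"
    proof
      fix m' assume "m' \<in> Poly_Mapping.keys (of_vec r f)"
      then obtain j v where jv: "m' = (j, v @ w)" "(j, v) \<in> Poly_Mapping.keys g" unfolding k by auto
      then have "((j, v), (i, u)) \<in> R" using g(3) by (auto simp: greatest_key_def)
      \<comment> \<open>Compatibility speaks only of strict inequalities, so the monomial itself is
        treated through reflexivity.\<close>
      show "(m', (i, u @ w)) \<in> R"
      proof (cases "(j, v) = (i, u)")
        case True
        have "(i, u @ w) \<in> monomials r" using m occurring_subset by (auto simp: keys_of_vec)
        then show ?thesis using True wo by (auto simp: jv order_on_defs refl_on_def)
      next
        case False
        then have "((j, v @ w), (i, u @ w)) \<in> R - Id"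
          using \<open>((j, v), (i, u)) \<in> R\<close> ordering unfolding monomial_ordering_def by blast
        then show ?thesis by (simp add: jv)
      qed
    qed
  qed
  then show ?thesis using of_vec_coeffs[OF f] by (auto simp: leading_def)
qed

text \<open>\<open>of_vec\<close> and \<open>to_vec\<close> are mutually inverse between
  \<open>coeffs\<close> and \<open>M\<close>, and a greatest key exists exactly for nonzero
  elements.\<close>

lemma leading_eq: "leading = {lm r R f | f. f \<in> M \<and> f \<noteq> \<zero>\<^bsub>FM\<^esub>}"
proof (intro subset_antisym subsetI)
  fix m assume "m \<in> leading"
  then obtain g where g: "Poly_Mapping.keys g \<subseteq> monomials r" "to_vec r g \<in> M" "greatest_key R g m"
    by (auto simp: leading_def coeffs_def)
  have og: "of_vec r (to_vec r g) = g" by (rule of_vec_to_vec[OF g(1)])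
  have "lm r R (to_vec r g) = m" by (rule lm_eqI[OF wo]) (simp add: og g)
  moreover have "to_vec r g \<noteq> \<zero>\<^bsub>FM\<^esub>"
  proof
    assume "to_vec r g = \<zero>\<^bsub>FM\<^esub>"
    then have "to_vec r g = to_vec r 0" by (simp add: to_vec_zero)
    then have "of_vec r (to_vec r g) = of_vec r (to_vec r 0)" by (rule arg_cong)
    then have "g = 0" by (simp add: og of_vec_to_vec)
    then show False using g(3) by (simp add: greatest_key_def)
  qed
  ultimately show "m \<in> {lm r R f | f. f \<in> M \<and> f \<noteq> \<zero>\<^bsub>FM\<^esub>}" using g(2) by blast
next
  fix m assume "m \<in> {lm r R f | f. f \<in> M \<and> f \<noteq> \<zero>\<^bsub>FM\<^esub>}"
  then obtain f where f: "f \<in> M" "f \<noteq> (\<lambda>i\<in>{1..r}. 0)" "m = lm r R f" by auto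
  have "of_vec r f \<noteq> 0"
  proof
    assume "of_vec r f = 0"
    then have "to_vec r (of_vec r f) = (\<lambda>i\<in>{1..r}. 0)" by (simp add: to_vec_zero)
    then show False using f M_carrier by (simp add: to_vec_of_vec)
  qed
  then obtain n where n: "greatest_key R (of_vec r f) n"
    using greatest_key_exists[OF wo] occurring_subset keys_of_vec by metis
  then show "m \<in> leading"
    using lm_eqI[OF wo n] of_vec_coeffs[OF f(1)] f(3) by (auto simp: leading_def)
qed

text \<open>The product is a submodule because \<open>leading\<close> is closed under right
  multiplication. It is the least one because a vector supported on \<open>leading\<close> is a
  finite sum of scaled \<open>mon_vec\<close> values.\<close>

lemma LM_eq: "LM r \<delta> R M = (\<Pi>\<^sub>E i\<in>{1..r}. word_span {w. (i, w) \<in> leading})"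
proof -
  let ?P = "\<Pi>\<^sub>E i\<in>{1..r}. (word_span {w. (i, w) \<in> leading} :: ('x, 'k) free_algebra set)"
  have P: "v \<in> ?P \<longleftrightarrow> v \<in> {1..r} \<rightarrow>\<^sub>E UNIV \<and> occurring r v \<subseteq> leading" for v
    by (auto simp: PiE_iff word_span_def occurring_def)
  have "LM r \<delta> R M = right_submodule FM hull (mon_vec r ` leading)"
    unfolding LM_def leading_eq by (rule arg_cong[where f = "\<lambda>S. right_submodule FM hull S"]) auto
  also have "\<dots> = ?P"
  proof (rule hull_unique)
    show "mon_vec r ` leading \<subseteq> ?P"
    proof
      fix v :: "nat \<Rightarrow> ('x, 'k) free_algebra"
      assume "v \<in> mon_vec r ` leading"
      then obtain m where m: "m \<in> leading" "v = mon_vec r m" by auto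
      moreover have "m \<in> monomials r" using m leading_subset by auto
      ultimately show "v \<in> ?P" unfolding P by (simp add: occurring_mon_vec) (simp add: mon_vec_def)
    qed
    have rc: "right_submodule (shifted 0) (word_span {w. (i, w) \<in> leading} :: ('x, 'k) free_algebra set)" for i
      by (intro right_submodule_word_span) (auto simp: right_closed_def leading_right_closed)
    show "right_submodule FM ?P"
      using rc unfolding right_submodule_free_module_iff right_submodule_shifted_iff by (auto simp: PiE_iff)
    fix N' assume N': "mon_vec r ` leading \<subseteq> N'" "right_submodule FM N'"
    have "to_vec r g \<in> N'" if "Poly_Mapping.keys g \<subseteq> leading" for g
      using that
    proof (induction g rule: poly_mapping_add_single_induct)
      case zero
      then show ?case using N'(2) unfolding right_submodule_free_module_iff to_vec_zero by (elim conjE)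
    next
      case (add f a b)
      then have "to_vec r f \<in> N'" "a \<in> leading" by (auto simp: keys_add_single)
      then show ?case
        using N' unfolding right_submodule_free_module_iff to_vec_add to_vec_single by blast
    qed
    then have "v \<in> N'" if "v \<in> ?P" for v
      using that unfolding P by (metis keys_of_vec to_vec_of_vec)
    then show "?P \<subseteq> N'" by blast
  qed
  finally show ?thesis .
qed

lemma leading_ideal: "word_span {w. (i, w) \<in> leading} \<in> (\<M>\<I> :: ('x, 'k) free_algebra set set)"
  unfolding monomial_right_ideals_eq using leading_right_closed by (auto simp: right_closed_def)

end

section \<open>Rational power series\<close>

text \<open>Multiplication of a series by the monomial with exponent \<open>\<beta>\<close>.
  Subtraction of exponents truncates at zero, so divisibility must be tested first.\<close>

definition shift_series :: "'x multidegree \<Rightarrow> ('x multidegree \<Rightarrow> int) \<Rightarrow> 'x multidegree \<Rightarrow> int"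
  where "shift_series \<beta> S \<alpha> = (if \<exists>\<gamma>. \<beta> + \<gamma> = \<alpha> then S (\<alpha> - \<beta>) else 0)"

lemma shift_series_add [simp]: "shift_series \<beta> S (\<beta> + \<gamma>) = S \<gamma>"
  by (auto simp: shift_series_def)

lemma shift_shift_series: "shift_series \<beta> (shift_series \<gamma> S) = shift_series (\<beta> + \<gamma>) S"
proof
  fix \<alpha>
  show "shift_series \<beta> (shift_series \<gamma> S) \<alpha> = shift_series (\<beta> + \<gamma>) S \<alpha>"
  proof (cases "\<exists>\<epsilon>. \<beta> + \<gamma> + \<epsilon> = \<alpha>")
    case True
    then obtain \<epsilon> where "\<alpha> = \<beta> + (\<gamma> + \<epsilon>)" by (auto simp: add.assoc)
    then show ?thesis using shift_series_add[of "\<beta> + \<gamma>" S \<epsilon>] by (simp add: add.assoc)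
  next
    case False
    then show ?thesis by (auto simp: shift_series_def add.assoc)
  qed
qed

text \<open>Both summands are bounded by \<open>\<alpha>\<close> in each of the finitely many
  variables. Over an infinite index set the sum in \<open>series_mult\<close> would default to
  zero.\<close>

lemma finite_add_eq: "finite {(\<beta>, \<gamma>). \<beta> + \<gamma> = (\<alpha> :: 'x::finite multidegree)}"
proof (rule finite_subset)
  let ?B = "{\<beta>. \<forall>x. Poly_Mapping.lookup \<beta> x \<le> Poly_Mapping.lookup \<alpha> x}"
  show "{(\<beta>, \<gamma>). \<beta> + \<gamma> = \<alpha>} \<subseteq> ?B \<times> ?B" by (auto simp: lookup_add)
  have "finite ((\<lambda>\<beta>. Poly_Mapping.lookup \<beta>) ` ?B)"
    by (rule finite_subset[of _ "PiE UNIV (\<lambda>x. {..Poly_Mapping.lookup \<alpha> x})"]) (auto intro: finite_PiE)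
  then have "finite ?B"
    by (rule finite_imageD) (auto simp: inj_on_def)
  then show "finite (?B \<times> ?B)" by simp
qed

text \<open>Typed as an action of the polynomial ring, so that power series form a module over it
  and the algebra of linear systems can be done there.\<close>

definition series_scale :: "('x multidegree \<Rightarrow>\<^sub>0 int) \<Rightarrow> ('x multidegree \<Rightarrow> int) \<Rightarrow> 'x multidegree \<Rightarrow> int"
  where "series_scale p S = series_mult (Poly_Mapping.lookup p) S"

lemma series_scale_add_left:
  fixes S :: "'x::finite multidegree \<Rightarrow> int"
  shows "series_scale (p + q) S = series_scale p S + series_scale q S"
  by (rule ext) (simp add: series_scale_def series_mult_def lookup_add case_prod_beta algebra_simps sum.distrib)

lemma series_scale_add_right:
  fixes S T :: "'x::finite multidegree \<Rightarrow> int"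
  shows "series_scale p (S + T) = series_scale p S + series_scale p T"
  by (rule ext) (simp add: series_scale_def series_mult_def case_prod_beta algebra_simps sum.distrib)

lemma series_scale_zero_left: "series_scale 0 S = 0"
  by (rule ext) (simp add: series_scale_def series_mult_def case_prod_beta)

lemma series_scale_single:
  fixes S :: "'x::finite multidegree \<Rightarrow> int"
  shows "series_scale (Poly_Mapping.single \<beta> c) S = (\<lambda>\<alpha>. c * shift_series \<beta> S \<alpha>)"
proof
  fix \<alpha>
  have "series_scale (Poly_Mapping.single \<beta> c) S \<alpha> =
      (\<Sum>(\<beta>', \<gamma>)\<in>{(\<beta>', \<gamma>). \<beta>' + \<gamma> = \<alpha>}. (c when \<beta> = \<beta>') * S \<gamma>)"
    by (simp add: series_scale_def series_mult_def lookup_single)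
  also have "\<dots> = (\<Sum>(\<beta>', \<gamma>)\<in>{(\<beta>', \<gamma>). \<beta>' = \<beta> \<and> \<beta> + \<gamma> = \<alpha>}. c * S \<gamma>)"
    by (rule sum.mono_neutral_cong_right[OF finite_add_eq]) (auto simp: when_def split: if_splits)
  also have "\<dots> = c * shift_series \<beta> S \<alpha>"
  proof (cases "\<exists>\<gamma>. \<beta> + \<gamma> = \<alpha>")
    case True
    then obtain \<gamma> where "\<alpha> = \<beta> + \<gamma>" by auto
    then have "{(\<beta>', \<gamma>). \<beta>' = \<beta> \<and> \<beta> + \<gamma> = \<alpha>} = {(\<beta>, \<gamma>)}" by auto
    then show ?thesis using \<open>\<alpha> = \<beta> + \<gamma>\<close> by simp
  next
    case False
    then have "{(\<beta>', \<gamma>). \<beta>' = \<beta> \<and> \<beta> + \<gamma> = \<alpha>} = {}" by auto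
    then show ?thesis using False by (simp add: shift_series_def)
  qed
  finally show "series_scale (Poly_Mapping.single \<beta> c) S \<alpha> = c * shift_series \<beta> S \<alpha>" .
qed

text \<open>Additivity in both polynomials reduces the claim to single terms, where it is the
  composition of two shifts.\<close>

lemma series_scale_assoc:
  fixes S :: "'x::finite multidegree \<Rightarrow> int"
  shows "series_scale p (series_scale q S) = series_scale (p * q) S"
proof (induction p rule: poly_mapping_add_single_induct)
  case (add p \<beta> b)
  have "series_scale (Poly_Mapping.single \<beta> b) (series_scale q S) = series_scale (Poly_Mapping.single \<beta> b * q) S"
  proof (induction q rule: poly_mapping_add_single_induct)
    case zero
    show ?case by (simp add: series_scale_zero_left series_scale_single fun_eq_iff shift_series_def)
  next
    case (add q \<gamma> c)
    have "shift_series \<beta> (\<lambda>\<alpha>. c * shift_series \<gamma> S \<alpha>) = (\<lambda>\<alpha>. c * shift_series (\<beta> + \<gamma>) S \<alpha>)"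
      unfolding shift_shift_series[symmetric] by (auto simp: shift_series_def)
    then have "series_scale (Poly_Mapping.single \<beta> b) (series_scale (Poly_Mapping.single \<gamma> c) S) =
        series_scale (Poly_Mapping.single \<beta> b * Poly_Mapping.single \<gamma> c) S"
      by (simp add: mult_single series_scale_single mult.assoc)
    then show ?case
      by (simp only: distrib_left series_scale_add_left series_scale_add_right add.IH)
  qed
  then show ?case
    by (simp only: distrib_right series_scale_add_left add.IH)
qed (simp add: series_scale_zero_left)

lemma series_scale_one:
  fixes S :: "'x::finite multidegree \<Rightarrow> int"
  shows "series_scale 1 S = S"
proof -
  have "series_scale (Poly_Mapping.single 0 1) S = S"
    unfolding series_scale_single by (simp add: shift_series_def)
  then show ?thesis by simp
qed

interpretation series: module "series_scale :: ('x::finite multidegree \<Rightarrow>\<^sub>0 int) \<Rightarrow> _"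
  by standard (simp_all only: series_scale_add_left series_scale_add_right series_scale_assoc series_scale_one)

lemma lookup_single_mult_shift:
  "Poly_Mapping.lookup (Poly_Mapping.single \<beta> c * q) = (\<lambda>\<alpha>. c * shift_series \<beta> (Poly_Mapping.lookup q) \<alpha>)"
proof (induction q rule: poly_mapping_add_single_induct)
  case zero
  show ?case by (simp add: shift_series_def fun_eq_iff)
next
  case (add q \<gamma> d)
  have "(d when \<beta> + \<gamma> = \<alpha>) = shift_series \<beta> (Poly_Mapping.lookup (Poly_Mapping.single \<gamma> d)) \<alpha>" for \<alpha>
    by (auto simp: shift_series_def lookup_single when_def)
  then show ?case
    using add.IH by (auto simp: fun_eq_iff distrib_left lookup_add mult_single lookup_single when_def shift_series_def algebra_simps)
qed

lemma series_scale_lookup: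
  fixes p q :: "'x::finite multidegree \<Rightarrow>\<^sub>0 int"
  shows "series_scale p (Poly_Mapping.lookup q) = Poly_Mapping.lookup (p * q)"
proof (induction p rule: poly_mapping_add_single_induct)
  case (add p \<beta> b)
  have "Poly_Mapping.lookup (p * q + Poly_Mapping.single \<beta> b * q) =
      Poly_Mapping.lookup (p * q) + Poly_Mapping.lookup (Poly_Mapping.single \<beta> b * q)"
    by (simp add: fun_eq_iff lookup_add)
  then show ?case
    by (simp only: distrib_right series_scale_add_left add.IH series_scale_single lookup_single_mult_shift)
qed (simp add: series_scale_zero_left fun_eq_iff)

text \<open>The exponent zero decomposes only as \<open>0 + 0\<close>, so taking constant
  coefficients is multiplicative.\<close>

lemma lookup_mult_zero:
  fixes p q :: "'x::finite multidegree \<Rightarrow>\<^sub>0 int"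
  shows "Poly_Mapping.lookup (p * q) 0 = Poly_Mapping.lookup p 0 * Poly_Mapping.lookup q 0"
proof -
  have zero: "\<beta> = 0 \<and> \<gamma> = 0" if "\<beta> + \<gamma> = 0" for \<beta> \<gamma> :: "'x multidegree"
  proof -
    have "Poly_Mapping.lookup (\<beta> + \<gamma>) x = 0" for x using that by simp
    then show ?thesis by (auto intro!: poly_mapping_eqI simp: lookup_add)
  qed
  have set: "{(\<beta>, \<gamma>). \<beta> + \<gamma> = (0 :: 'x multidegree)} = {(0, 0)}" by (auto dest: zero)
  have "Poly_Mapping.lookup (p * q) 0 = series_mult (Poly_Mapping.lookup p) (Poly_Mapping.lookup q) 0"
    by (metis series_scale_lookup series_scale_def)
  also have "\<dots> = Poly_Mapping.lookup p 0 * Poly_Mapping.lookup q 0"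
    unfolding series_mult_def set by simp
  finally show ?thesis .
qed

text \<open>A normalised form of \<open>is_rational_function\<close>: the denominator has constant
  coefficient exactly \<open>1\<close>, a condition preserved by products.\<close>

definition rational_series :: "('x multidegree \<Rightarrow> int) \<Rightarrow> bool"
  where "rational_series S \<longleftrightarrow>
    (\<exists>d p. Poly_Mapping.lookup d 0 = 1 \<and> series_scale d S = Poly_Mapping.lookup p)"

lemma rational_series_imp: "rational_series S \<Longrightarrow> is_rational_function S"
  unfolding rational_series_def is_rational_function_def series_scale_def by (metis zero_neq_one)

lemma rational_series_lookup: "rational_series (Poly_Mapping.lookup p :: 'x::finite multidegree \<Rightarrow> int)"
  unfolding rational_series_def
  by (intro exI[of _ 1] exI[of _ p]) (simp add: series_scale_one lookup_one)

lemma rational_series_zero: "rational_series (0 :: 'x::finite multidegree \<Rightarrow> int)"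
proof -
  have "Poly_Mapping.lookup 0 = (0 :: 'x multidegree \<Rightarrow> int)" by (rule ext) simp
  then show ?thesis by (metis rational_series_lookup)
qed

section \<open>Closure properties of rational series and linear systems\<close>

lemma rational_series_add:
  fixes S T :: "'x::finite multidegree \<Rightarrow> int"
  assumes "rational_series S" "rational_series T"
  shows "rational_series (S + T)"
proof -
  obtain d p e q where S: "Poly_Mapping.lookup d 0 = 1" "series_scale d S = Poly_Mapping.lookup p"
    and T: "Poly_Mapping.lookup e 0 = 1" "series_scale e T = Poly_Mapping.lookup q"
    using assms unfolding rational_series_def by blast
  have "series_scale (d * e) (S + T) = series_scale e (series_scale d S) + series_scale d (series_scale e T)"
    by (simp only: series_scale_add_right series_scale_assoc mult.commute)
  also have "\<dots> = Poly_Mapping.lookup (e * p + d * q)"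
    by (simp add: S T series_scale_lookup fun_eq_iff lookup_add)
  finally show ?thesis
    unfolding rational_series_def using S T by (intro exI[of _ "d * e"] exI conjI) (auto simp: lookup_mult_zero)
qed

lemma rational_series_scale:
  fixes S :: "'x::finite multidegree \<Rightarrow> int"
  assumes "rational_series S"
  shows "rational_series (series_scale a S)"
proof -
  obtain d p where S: "Poly_Mapping.lookup d 0 = 1" "series_scale d S = Poly_Mapping.lookup p"
    using assms unfolding rational_series_def by blast
  have "series_scale d (series_scale a S) = series_scale a (series_scale d S)"
    by (simp only: series_scale_assoc mult.commute)
  also have "\<dots> = Poly_Mapping.lookup (a * p)" by (simp add: S series_scale_lookup)
  finally show ?thesis unfolding rational_series_def using S(1) by blast
qed

lemma rational_series_sum:
  fixes H :: "'i \<Rightarrow> 'x::finite multidegree \<Rightarrow> int"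
  assumes "\<And>i. i \<in> A \<Longrightarrow> rational_series (H i)"
  shows "rational_series (\<Sum>i\<in>A. H i)"
  using assms
proof (induction A rule: infinite_finite_induct)
  case (insert i A)
  then show ?case unfolding sum.insert[OF insert.hyps] by (intro rational_series_add) auto
qed (simp_all add: rational_series_zero)

lemma rational_series_divide:
  fixes S :: "'x::finite multidegree \<Rightarrow> int"
  assumes "rational_series (series_scale d S)" "Poly_Mapping.lookup d 0 = 1"
  shows "rational_series S"
proof -
  obtain e p where e: "Poly_Mapping.lookup e 0 = 1" "series_scale e (series_scale d S) = Poly_Mapping.lookup p"
    using assms unfolding rational_series_def by blast
  then show ?thesis
    unfolding rational_series_def using assms(2)
    by (intro exI[of _ "e * d"] exI[of _ p]) (simp add: lookup_mult_zero series_scale_assoc)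
qed

text \<open>The diagonal factors \<open>q j\<close> are part of the statement because eliminating an
  unknown multiplies the other equations by the pivot. The \<open>a j k\<close> keep vanishing
  constant coefficients throughout, so each later pivot again starts with \<open>1\<close>.\<close>

lemma rational_series_linear_system:
  fixes H :: "'j \<Rightarrow> 'x::finite multidegree \<Rightarrow> int"
  assumes "finite J"
    and "\<And>j. j \<in> J \<Longrightarrow> Poly_Mapping.lookup (q j) 0 = 1"
    and "\<And>j k. j \<in> J \<Longrightarrow> k \<in> J \<Longrightarrow> Poly_Mapping.lookup (a j k) 0 = 0"
    and "\<And>j. j \<in> J \<Longrightarrow>
      series_scale (q j) (H j) = Poly_Mapping.lookup (c j) + (\<Sum>k\<in>J. series_scale (a j k) (H k))"
    and "j \<in> J"
  shows "rational_series (H j)"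
  using assms
proof (induction J arbitrary: q a c j rule: finite_induct)
  case (insert i J)
  note q = insert.prems(1) and a = insert.prems(2) and sys = insert.prems(3)
  \<comment> \<open>Gaussian elimination of the unknown \<open>i\<close>; the pivot \<open>d\<close> has constant coefficient \<open>1\<close>.\<close>
  define d where "d = q i - a i i"
  have d: "Poly_Mapping.lookup d 0 = 1" using q[of i] a[of i i] by (simp add: d_def lookup_minus)
  have di: "series_scale d (H i) = Poly_Mapping.lookup (c i) + (\<Sum>k\<in>J. series_scale (a i k) (H k))"
    using sys[of i] insert.hyps by (simp add: d_def series.scale_left_diff_distrib del: plus_fun_apply)
  have J: "rational_series (H k)" if "k \<in> J" for k
  \<comment> \<open>The new coefficients are those of \<open>d\<close> times the equation for
    \<open>j\<close>, in which \<open>d\<close> times \<open>H i\<close> has been replaced by the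
    right-hand side of \<open>di\<close>.\<close>
  proof (rule insert.IH[of "\<lambda>j. d * q j" "\<lambda>j k. d * a j k + a j i * a i k" "\<lambda>j. d * c j + a j i * c i"])
    show "Poly_Mapping.lookup (d * q j) 0 = 1" if "j \<in> J" for j
      using that d q by (simp add: lookup_mult_zero)
    show "Poly_Mapping.lookup (d * a j k + a j i * a i k) 0 = 0" if "j \<in> J" "k \<in> J" for j k
      using that a by (simp add: lookup_mult_zero lookup_add)
    fix j assume j: "j \<in> J"
    have "series_scale (d * q j) (H j) = series_scale d (series_scale (q j) (H j))"
      by (simp only: series_scale_assoc)
    also have "\<dots> = series_scale d (Poly_Mapping.lookup (c j)) + series_scale d (series_scale (a j i) (H i))
        + series_scale d (\<Sum>k\<in>J. series_scale (a j k) (H k))"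
      using sys[of j] j insert.hyps by (simp add: series.scale_right_distrib add.assoc del: plus_fun_apply)
    also have "series_scale d (series_scale (a j i) (H i)) = series_scale (a j i) (series_scale d (H i))"
      by (simp only: series_scale_assoc mult.commute)
    also have "\<dots> = series_scale (a j i) (Poly_Mapping.lookup (c i)) + (\<Sum>k\<in>J. series_scale (a j i * a i k) (H k))"
      unfolding di by (simp add: series.scale_right_distrib series.scale_sum_right del: plus_fun_apply)
    also have "series_scale d (\<Sum>k\<in>J. series_scale (a j k) (H k)) = (\<Sum>k\<in>J. series_scale (d * a j k) (H k))"
      by (simp add: series.scale_sum_right)
    also have "series_scale d (Poly_Mapping.lookup (c j)) +
        (series_scale (a j i) (Poly_Mapping.lookup (c i)) + (\<Sum>k\<in>J. series_scale (a j i * a i k) (H k))) +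
        (\<Sum>k\<in>J. series_scale (d * a j k) (H k)) =
        Poly_Mapping.lookup (d * c j + a j i * c i) + (\<Sum>k\<in>J. series_scale (d * a j k + a j i * a i k) (H k))"
    proof -
      have "Poly_Mapping.lookup (d * c j + a j i * c i) = Poly_Mapping.lookup (d * c j) + Poly_Mapping.lookup (a j i * c i)"
        by (simp add: fun_eq_iff lookup_add)
      then show ?thesis
        by (simp add: series_scale_lookup series.scale_left_distrib sum.distrib add_ac del: plus_fun_apply)
    qed
    finally show "series_scale (d * q j) (H j) =
        Poly_Mapping.lookup (d * c j + a j i * c i) + (\<Sum>k\<in>J. series_scale (d * a j k + a j i * a i k) (H k))" .
  qed (rule that)
  \<comment> \<open>Back substitution: the other unknowns are now rational, and only the division by
    \<open>d\<close> is left.\<close>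
  have "rational_series (series_scale d (H i))"
    unfolding di by (rule rational_series_add[OF rational_series_lookup rational_series_sum[OF rational_series_scale[OF J]]])
  then have "rational_series (H i)" using d by (rule rational_series_divide)
  with J insert.prems(4) show ?case by (metis insert_iff)
qed simp

section \<open>Regular ideals\<close>

lemma ideal_orbit_self: "I \<in> ideal_orbit I"
  unfolding ideal_orbit_def by (rule hull_inc) simp

text \<open>Every family in the intersection that defines the hull is closed under
  \<open>T_var x\<close>, hence so is the intersection.\<close>

lemma T_var_ideal_orbit:
  assumes "J \<in> ideal_orbit I"
  shows "T_var x J \<in> ideal_orbit I"
  unfolding ideal_orbit_def hull_def
proof (rule InterI)
  fix A assume A: "A \<in> {A. (A \<subseteq> \<M>\<I> \<and> (\<forall>x. T_var x ` A \<subseteq> A)) \<and> {I} \<subseteq> A}"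
  then have "J \<in> A" using assms unfolding ideal_orbit_def hull_def by (rule InterD[rotated])
  moreover have "T_var x ` A \<subseteq> A" using A by simp
  ultimately show "T_var x J \<in> A" by auto
qed

text \<open>For \<open>J\<close> in \<open>\<M>\<I>\<close> this is the Hilbert series of F/J
  without shift, in the combinatorial form in which the recursion is a bijection of words.\<close>

definition normal_series :: "('x, 'k::field) free_algebra set \<Rightarrow> 'x multidegree \<Rightarrow> int"
  where "normal_series J \<beta> = int (card {w. word w \<notin> J \<and> mdeg w = \<beta>})"

lemma shift_normal_series:
  "shift_series \<delta> (normal_series J) \<alpha> = int (card {w. word w \<notin> J \<and> \<delta> + mdeg w = \<alpha>})"
proof (cases "\<exists>\<gamma>. \<delta> + \<gamma> = \<alpha>")
  case True
  then obtain \<gamma> where "\<alpha> = \<delta> + \<gamma>" by auto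
  then show ?thesis by (simp add: normal_series_def)
next
  case False
  then have "{w. word w \<notin> J \<and> \<delta> + mdeg w = \<alpha>} = {}" by auto
  then show ?thesis using False by (simp add: shift_series_def)
qed

text \<open>\<open>word (x # w)\<close> lies in \<open>J\<close> iff \<open>word w\<close> lies in
  \<open>T_var x J\<close>, so prefixing \<open>x\<close> maps the words outside
  \<open>T_var x J\<close> bijectively onto the words outside \<open>J\<close> that begin with
  \<open>x\<close>.\<close>

lemma normal_series_rec:
  fixes J :: "('x::finite, 'k::field) free_algebra set"
  shows "normal_series J = Poly_Mapping.lookup (if word [] \<in> J then 0 else 1) +
    (\<Sum>x\<in>UNIV. series_scale (Poly_Mapping.single (Poly_Mapping.single x 1) 1) (normal_series (T_var x J)))"
proof
  fix \<beta> :: "'x multidegree"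
  \<comment> \<open>\<open>A\<close> holds at most the empty word and yields the constant term;
    \<open>B x\<close> collects the words with first letter \<open>x\<close>.\<close>
  define A where "A = {w :: 'x list. w = [] \<and> word [] \<notin> J \<and> \<beta> = 0}"
  define B where "B x = Cons x ` {w. word w \<notin> T_var x J \<and> Poly_Mapping.single x 1 + mdeg w = \<beta>}" for x
  have fin: "finite (B x)" for x
    unfolding B_def
    by (intro finite_imageI finite_subset[OF _ finite_mdeg_eq[of "Poly_Mapping.single x 1" \<beta>]]) auto
  have cardB: "int (card (B x)) = shift_series (Poly_Mapping.single x 1) (normal_series (T_var x J)) \<beta>" for x
    unfolding shift_normal_series B_def by (subst card_image) auto
  have T: "word w \<in> T_var x J \<longleftrightarrow> word (x # w) \<in> J" for x w
    by (simp add: T_var_def word_mult_word)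
  have eq: "{w. word w \<notin> J \<and> mdeg w = \<beta>} = A \<union> (\<Union>x. B x)"
  proof (rule Set.set_eqI)
    fix w
    show "w \<in> {w. word w \<notin> J \<and> mdeg w = \<beta>} \<longleftrightarrow> w \<in> A \<union> (\<Union>x. B x)"
      by (cases w) (auto simp: A_def B_def T mdeg_Cons)
  qed
  have "card (A \<union> (\<Union>x. B x)) = card A + card (\<Union>x. B x)"
    by (rule card_Un_disjoint) (use fin in \<open>auto simp: A_def B_def\<close>)
  also have "card (\<Union>x. B x) = (\<Sum>x\<in>UNIV. card (B x))"
    by (rule card_UN_disjoint) (use fin in \<open>auto simp: B_def\<close>)
  finally have "normal_series J \<beta> = int (card A) + (\<Sum>x\<in>UNIV. int (card (B x)))"
    by (simp add: normal_series_def eq)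
  moreover have "int (card A) = Poly_Mapping.lookup (if word [] \<in> J then 0 else 1) \<beta>"
    by (auto simp: A_def lookup_one when_def)
  moreover have "(\<Sum>x\<in>UNIV. int (card (B x))) =
      (\<Sum>x\<in>UNIV. series_scale (Poly_Mapping.single (Poly_Mapping.single x 1) 1) (normal_series (T_var x J))) \<beta>"
  proof -
    have ap: "(\<Sum>x\<in>A. F x) \<beta> = (\<Sum>x\<in>A. F x \<beta>)" for A and F :: "'x \<Rightarrow> 'x multidegree \<Rightarrow> int"
      by (induction A rule: infinite_finite_induct) simp_all
    show ?thesis unfolding ap by (simp add: cardB series_scale_single)
  qed
  ultimately show "normal_series J \<beta> = (Poly_Mapping.lookup (if word [] \<in> J then 0 else 1) +
      (\<Sum>x\<in>UNIV. series_scale (Poly_Mapping.single (Poly_Mapping.single x 1) 1) (normal_series (T_var x J)))) \<beta>"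
    by simp
qed

text \<open>The orbit is closed under every \<open>T_var x\<close>, so the recursions of its members
  form a square system, and it is finite by regularity.\<close>

lemma rational_normal_series:
  fixes I :: "('x::finite, 'k::field) free_algebra set"
  assumes "regular_ideal I"
  shows "rational_series (normal_series I)"
proof -
  let ?t = "\<lambda>x :: 'x. Poly_Mapping.single (Poly_Mapping.single x (1::nat)) (1::int)"
  \<comment> \<open>The weighted transition matrix of the automaton. Several letters may lead from
    \<open>J\<close> to the same \<open>K\<close>, hence a sum of variables.\<close>
  define a where "a J K = (\<Sum>x\<in>{x. T_var x J = K}. ?t x)" for J K :: "('x, 'k) free_algebra set"
  show ?thesis
  proof (rule rational_series_linear_system[where J = "ideal_orbit I" and q = "\<lambda>_. 1" and a = a
        and c = "\<lambda>J. if word [] \<in> J then 0 else 1"])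
    show fin: "finite (ideal_orbit I)" using assms by (simp add: regular_ideal_def)
    show "Poly_Mapping.lookup (a J K) 0 = 0" for J K
    proof -
      have "Poly_Mapping.single x (1::nat) \<noteq> 0" for x :: 'x
        by (metis keys_single keys_zero insert_not_empty one_neq_zero)
      then show ?thesis by (simp add: a_def lookup_sum lookup_single when_def)
    qed
    fix J assume J: "J \<in> ideal_orbit I"
    have "(\<Sum>K\<in>ideal_orbit I. series_scale (a J K) (normal_series K)) =
        (\<Sum>K\<in>ideal_orbit I. \<Sum>x\<in>{x \<in> UNIV. T_var x J = K}. series_scale (?t x) (normal_series (T_var x J)))"
      unfolding a_def series.scale_sum_left by (intro sum.cong) auto
    also have "\<dots> = (\<Sum>x\<in>UNIV. series_scale (?t x) (normal_series (T_var x J)))"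
      by (rule sum.group) (use fin T_var_ideal_orbit[OF J] in auto)
    finally show "series_scale 1 (normal_series J) = Poly_Mapping.lookup (if word [] \<in> J then 0 else 1) +
        (\<Sum>K\<in>ideal_orbit I. series_scale (a J K) (normal_series K))"
      unfolding series_scale_one by (simp only: normal_series_rec[symmetric])
  qed (simp_all add: ideal_orbit_self)
qed

section \<open>Shifted summands, the direct sum decomposition and the conclusion\<close>

lemma HS_quot_shifted:
  fixes I :: "('x::finite, 'k::field) free_algebra set"
  assumes "I \<in> \<M>\<I>"
  shows "HS (quot_rmodule (shifted \<delta>) I) = series_scale (Poly_Mapping.single \<delta> 1) (normal_series I)"
proof
  fix \<alpha> :: "'x multidegree"
  obtain S where S: "I = word_span S" "right_closed S"
    using assms unfolding monomial_right_ideals_eq by blast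
  show "HS (quot_rmodule (shifted \<delta>) I) \<alpha> = series_scale (Poly_Mapping.single \<delta> 1) (normal_series I) \<alpha>"
    by (simp add: series_scale_single shift_normal_series S HS_word_span)
qed

text \<open>The isomorphism sends a coset to the family of its coordinate projections. Taking images
  of the coset as a set avoids any choice of representatives.\<close>

lemma graded_isomorphic_quot_direct_sum:
  fixes I :: "nat \<Rightarrow> ('x, 'k::field) free_algebra set"
  assumes I: "\<And>i. i \<in> {1..r} \<Longrightarrow> right_submodule (shifted (\<delta> i)) (I i)"
  shows "graded_isomorphic (quot_rmodule (free_module r \<delta>) (\<Pi>\<^sub>E i\<in>{1..r}. I i))
    (dsum_rmodule {1..r} (\<lambda>i. quot_rmodule (shifted (\<delta> i)) (I i)))"
proof -
  let ?FM = "free_module r \<delta> :: (nat \<Rightarrow> ('x, 'k) free_algebra, ('x, 'k) free_algebra, 'x multidegree) graded_rmodule"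
  let ?N = "\<lambda>i. shifted (\<delta> i) :: (('x, 'k) free_algebra, ('x, 'k) free_algebra, 'x multidegree) graded_rmodule"
  let ?P = "\<Pi>\<^sub>E i\<in>{1..r}. I i"
  let ?D = "dsum_rmodule {1..r} (\<lambda>i. quot_rmodule (?N i) (I i))"
  interpret FM: right_module ?FM by (rule right_module_free_module)
  interpret N: right_module "?N i" for i by (rule right_module_shifted)
  have I': "0 \<in> I i" "\<And>f g. f \<in> I i \<Longrightarrow> g \<in> I i \<Longrightarrow> f + g \<in> I i" "\<And>f a. f \<in> I i \<Longrightarrow> f * a \<in> I i"
    if "i \<in> {1..r}" for i
    using I[OF that] by (simp_all add: right_submodule_shifted_iff)
  have P: "right_submodule ?FM ?P"
    unfolding right_submodule_free_module_iff using I' by (auto simp: PiE_iff)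
  define \<kappa> where "\<kappa> v = ?P +>\<^bsub>?FM\<^esub> v" for v
  define \<kappa>' where "\<kappa>' v = (\<lambda>i\<in>{1..r}. I i +>\<^bsub>?N i\<^esub> v i)" for v
  define \<phi> where "\<phi> C = (\<lambda>i\<in>{1..r}. (\<lambda>f. f i) ` C)" for C :: "(nat \<Rightarrow> ('x, 'k) free_algebra) set"
  have mem: "v \<in> carrier ?FM \<Longrightarrow> u \<in> \<kappa> v \<longleftrightarrow> u \<in> carrier ?FM \<and> (\<forall>i\<in>{1..r}. u i - v i \<in> I i)" for u v
  proof
    assume "u \<in> \<kappa> v"
    then obtain h where "h \<in> ?P" "u = (\<lambda>i\<in>{1..r}. h i + v i)"
      by (auto simp: \<kappa>_def a_r_coset_def')
    then show "u \<in> carrier ?FM \<and> (\<forall>i\<in>{1..r}. u i - v i \<in> I i)" by (auto simp: PiE_iff)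
  next
    assume u: "u \<in> carrier ?FM \<and> (\<forall>i\<in>{1..r}. u i - v i \<in> I i)"
    let ?h = "\<lambda>i\<in>{1..r}. u i - v i"
    have "?h \<in> ?P" using u by auto
    moreover have "u = ?h \<oplus>\<^bsub>?FM\<^esub> v"
      using u by (auto simp: fun_eq_iff PiE_iff extensional_def)
    ultimately show "u \<in> \<kappa> v" unfolding \<kappa>_def a_r_coset_def' by blast
  qed
  have mem': "f \<in> I i +>\<^bsub>?N i\<^esub> g \<longleftrightarrow> f - g \<in> I i" for f g i
    by (auto simp: a_r_coset_def' intro!: bexI[of _ "f - g"])
  have \<phi>\<kappa>: "\<phi> (\<kappa> v) = \<kappa>' v" if v: "v \<in> carrier ?FM" for v
  proof -
    have "(\<lambda>f. f i) ` \<kappa> v = I i +>\<^bsub>?N i\<^esub> v i" if i: "i \<in> {1..r}" for i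
    proof (intro subset_antisym subsetI)
      fix f assume "f \<in> (\<lambda>f. f i) ` \<kappa> v"
      then show "f \<in> I i +>\<^bsub>?N i\<^esub> v i" using i mem[OF v] mem' by auto
    next
      fix f assume f: "f \<in> I i +>\<^bsub>?N i\<^esub> v i"
      \<comment> \<open>Changing only coordinate \<open>i\<close> stays in the coset: every other
        difference is zero, which lies in each ideal.\<close>
      have "v(i := f) \<in> \<kappa> v"
        unfolding mem[OF v] using f[unfolded mem'] i v I'(1) by (auto simp: PiE_iff extensional_def)
      then show "f \<in> (\<lambda>f. f i) ` \<kappa> v" by (rule image_eqI[rotated]) simp
    qed
    then show ?thesis unfolding \<phi>_def \<kappa>'_def by (intro restrict_ext) simp
  qed
  have inj: "\<kappa> u = \<kappa> v" if u: "u \<in> carrier ?FM" and v: "v \<in> carrier ?FM" and eq: "\<kappa>' u = \<kappa>' v" for u v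
  proof -
    have "u i - v i \<in> I i" if i: "i \<in> {1..r}" for i
    proof -
      have "\<kappa>' u i = \<kappa>' v i" using eq by simp
      then have "I i +>\<^bsub>?N i\<^esub> u i = I i +>\<^bsub>?N i\<^esub> v i" using i by (simp add: \<kappa>'_def)
      then show ?thesis using N.coset_eq_iff[OF I[OF i], of "u i" "v i"] mem' by simp
    qed
    then have "u \<in> \<kappa> v" using mem[OF v] u by blast
    then show ?thesis unfolding \<kappa>_def by (rule FM.coset_eqI[OF P v])
  qed
  \<comment> \<open>For arbitrary \<open>H\<close>, so that one argument serves both the carrier and
    the homogeneous components; representatives are chosen in each coordinate.\<close>
  have img: "\<kappa>' ` (\<Pi>\<^sub>E i\<in>{1..r}. H i) = (\<Pi>\<^sub>E i\<in>{1..r}. (\<lambda>f. I i +>\<^bsub>?N i\<^esub> f) ` H i)" for H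
  proof (intro subset_antisym subsetI)
    fix y assume y: "y \<in> (\<Pi>\<^sub>E i\<in>{1..r}. (\<lambda>f. I i +>\<^bsub>?N i\<^esub> f) ` H i)"
    then have "\<forall>i\<in>{1..r}. \<exists>f. f \<in> H i \<and> y i = I i +>\<^bsub>?N i\<^esub> f" by (auto simp: PiE_iff)
    then obtain v where v: "\<And>i. i \<in> {1..r} \<Longrightarrow> v i \<in> H i \<and> y i = I i +>\<^bsub>?N i\<^esub> v i"
      using bchoice by metis
    have "y = \<kappa>' (restrict v {1..r})"
      by (rule PiE_ext[OF y]) (use v in \<open>auto simp: \<kappa>'_def\<close>)
    moreover have "restrict v {1..r} \<in> (\<Pi>\<^sub>E i\<in>{1..r}. H i)" using v by auto
    ultimately show "y \<in> \<kappa>' ` (\<Pi>\<^sub>E i\<in>{1..r}. H i)" by blast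
  qed (auto simp: \<kappa>'_def)
  have carrier: "carrier (quot_rmodule ?FM ?P) = \<kappa> ` carrier ?FM"
    unfolding FM.carrier_quot \<kappa>_def ..
  have hcomp: "hcomp (quot_rmodule ?FM ?P) \<alpha> = \<kappa> ` hcomp ?FM \<alpha>" for \<alpha>
    unfolding FM.hcomp_quot \<kappa>_def ..
  have \<phi>img: "\<phi> ` \<kappa> ` V = \<kappa>' ` V" if "V \<subseteq> carrier ?FM" for V
    unfolding image_image by (rule image_cong) (use that \<phi>\<kappa> in auto)
  show ?thesis
    unfolding graded_isomorphic_def
  proof (intro exI[of _ \<phi>] conjI ballI allI)
    show "bij_betw \<phi> (carrier (quot_rmodule ?FM ?P)) (carrier ?D)"
      unfolding bij_betw_def
    proof
      show "inj_on \<phi> (carrier (quot_rmodule ?FM ?P))"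
        unfolding carrier by (intro inj_onI) (metis (no_types, lifting) \<phi>\<kappa> imageE inj)
      have "carrier ?D = (\<Pi>\<^sub>E i\<in>{1..r}. (\<lambda>f. I i +>\<^bsub>?N i\<^esub> f) ` UNIV)"
        unfolding dsum_rmodule_def by (simp add: N.carrier_quot)
      then show "\<phi> ` carrier (quot_rmodule ?FM ?P) = carrier ?D"
        unfolding carrier \<phi>img[OF subset_refl] using img[of "\<lambda>_. UNIV"] by simp
    qed
    have hc: "hcomp ?FM \<alpha> \<subseteq> carrier ?FM" for \<alpha> by (auto simp: PiE_iff)
    have "hcomp ?D \<alpha> = (\<Pi>\<^sub>E i\<in>{1..r}. (\<lambda>f. I i +>\<^bsub>?N i\<^esub> f) ` hcomp (?N i) \<alpha>)" for \<alpha>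
      unfolding dsum_rmodule_def by (simp add: N.hcomp_quot)
    then show "\<phi> ` hcomp (quot_rmodule ?FM ?P) \<alpha> = hcomp ?D \<alpha>" for \<alpha>
      unfolding hcomp \<phi>img[OF hc] using img[of "\<lambda>i. hcomp (?N i) \<alpha>"] by simp
    fix C assume "C \<in> carrier (quot_rmodule ?FM ?P)"
    then obtain u where u: "u \<in> carrier ?FM" "C = \<kappa> u" unfolding carrier by auto
    show "\<phi> (ract (quot_rmodule ?FM ?P) C a) = ract ?D (\<phi> C) a" for a
    proof -
      have "ract (quot_rmodule ?FM ?P) C a = \<kappa> (ract ?FM u a)"
        unfolding u(2) \<kappa>_def by (rule FM.ract_quot[OF P u(1)])
      then have "\<phi> (ract (quot_rmodule ?FM ?P) C a) = \<kappa>' (ract ?FM u a)"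
        using \<phi>\<kappa>[OF FM.ract_closed[OF u(1)]] by simp
      also have "\<dots> = ract ?D (\<kappa>' u) a"
        by (auto simp: \<kappa>'_def dsum_rmodule_def fun_eq_iff N.ract_quot[OF I])
      finally show ?thesis unfolding u(2) \<phi>\<kappa>[OF u(1)] .
    qed
    fix C' assume "C' \<in> carrier (quot_rmodule ?FM ?P)"
    then obtain v where v: "v \<in> carrier ?FM" "C' = \<kappa> v" unfolding carrier by auto
    have "C \<oplus>\<^bsub>quot_rmodule ?FM ?P\<^esub> C' = \<kappa> (u \<oplus>\<^bsub>?FM\<^esub> v)"
      unfolding u(2) v(2) \<kappa>_def by (rule FM.add_quot[OF P u(1) v(1)])
    then have "\<phi> (C \<oplus>\<^bsub>quot_rmodule ?FM ?P\<^esub> C') = \<kappa>' (u \<oplus>\<^bsub>?FM\<^esub> v)"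
      using \<phi>\<kappa>[OF FM.a_closed[OF u(1) v(1)]] by simp
    also have "\<dots> = \<kappa>' u \<oplus>\<^bsub>?D\<^esub> \<kappa>' v"
      by (auto simp: \<kappa>'_def dsum_rmodule_def fun_eq_iff N.add_quot[OF I])
    finally show "\<phi> (C \<oplus>\<^bsub>quot_rmodule ?FM ?P\<^esub> C') = \<phi> C \<oplus>\<^bsub>?D\<^esub> \<phi> C'"
      unfolding u(2) v(2) \<phi>\<kappa>[OF u(1)] \<phi>\<kappa>[OF v(1)] .
  qed
qed

text \<open>Unique existence makes the ideals I_i well defined; the other claims then concern every
  family that decomposes the leading module, which can only be this one.\<close>

theorem theorem5p6:
  fixes r :: nat
    and \<delta> :: "nat \<Rightarrow> 'x::finite multidegree"
    and M :: "(nat \<Rightarrow> ('x, 'k::field) free_algebra) set"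
    and R :: "(nat \<times> 'x list) rel"
  assumes "right_submodule (free_module r \<delta>) M"
    and "multigraded (free_module r \<delta>) M"
    and "monomial_ordering r R"
  shows "(\<exists>!I. I \<in> {1..r} \<rightarrow>\<^sub>E \<M>\<I> \<and> LM r \<delta> R M = (\<Pi>\<^sub>E i\<in>{1..r}. I i)) \<and>
    (\<forall>I \<in> {1..r} \<rightarrow>\<^sub>E \<M>\<I>. LM r \<delta> R M = (\<Pi>\<^sub>E i\<in>{1..r}. I i) \<longrightarrow>
      graded_isomorphic
        (quot_rmodule (free_module r \<delta>) (LM r \<delta> R M))
        (dsum_rmodule {1..r} (\<lambda>i. quot_rmodule (shifted (\<delta> i)) (I i))) \<and>
      ((\<forall>i\<in>{1..r}. regular_ideal (I i)) \<longrightarrow>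
        HS (quot_rmodule (free_module r \<delta>) M) =
          (\<lambda>\<alpha>. \<Sum>i=1..r. HS (quot_rmodule (shifted (\<delta> i)) (I i)) \<alpha>) \<and>
        is_rational_function (HS (quot_rmodule (free_module r \<delta>) M))))"
proof -
  interpret leading_monomials r \<delta> M R using assms by unfold_locales
  define I0 where "I0 = (\<lambda>i\<in>{1..r}. word_span {w. (i, w) \<in> leading} :: ('x, 'k) free_algebra set)"
  have I0: "I0 \<in> {1..r} \<rightarrow>\<^sub>E \<M>\<I>" using leading_ideal by (auto simp: I0_def)
  have LM: "LM r \<delta> R M = (\<Pi>\<^sub>E i\<in>{1..r}. I0 i)"
    unfolding LM_eq I0_def by (intro PiE_cong) simp
  \<comment> \<open>A product of sets determines its factors only if none of them is empty; each
    ideal contains zero.\<close>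
  have nonempty: "J \<noteq> {}" if "J \<in> \<M>\<I>" for J :: "('x, 'k) free_algebra set"
  proof -
    have "0 \<in> J" using that unfolding monomial_right_ideals_eq by (auto simp: word_span_def)
    then show ?thesis by blast
  qed
  have unique: "I = I0" if I: "I \<in> {1..r} \<rightarrow>\<^sub>E \<M>\<I>" "LM r \<delta> R M = (\<Pi>\<^sub>E i\<in>{1..r}. I i)" for I
  proof (rule PiE_ext[OF I(1) I0])
    have "(\<Pi>\<^sub>E i\<in>{1..r}. I i) = (\<Pi>\<^sub>E i\<in>{1..r}. I0 i)" using I(2) LM by simp
    then have "\<forall>i\<in>{1..r}. I i = I0 i"
      by (subst (asm) PiE_eq_iff_not_empty) (use nonempty PiE_mem[OF I(1)] PiE_mem[OF I0] in blast)+
    then show "I i = I0 i" if "i \<in> {1..r}" for i using that by blast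
  qed
  have "right_submodule (shifted (\<delta> i)) (I0 i)" if "i \<in> {1..r}" for i
    using that leading_right_closed
    by (auto simp: I0_def right_closed_def intro!: right_submodule_word_span)
  then have iso: "graded_isomorphic (quot_rmodule (free_module r \<delta>) (LM r \<delta> R M))
      (dsum_rmodule {1..r} (\<lambda>i. quot_rmodule (shifted (\<delta> i)) (I0 i)))"
    unfolding LM by (rule graded_isomorphic_quot_direct_sum)
  have HS: "HS (quot_rmodule FM M) \<alpha> = (\<Sum>i=1..r. HS (quot_rmodule (shifted (\<delta> i)) (I0 i)) \<alpha>)" for \<alpha>
  proof -
    \<comment> \<open>Sorting the monomials outside \<open>leading\<close> by their index
      \<open>i\<close> splits the count in \<open>HS_quot\<close> into the counts of
      \<open>HS_word_span\<close>.\<close>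
    let ?B = "\<lambda>i. {w. (i, w) \<notin> leading \<and> \<delta> i + mdeg w = \<alpha>}"
    have "HS (quot_rmodule (shifted (\<delta> i)) (I0 i)) \<alpha> = int (card (?B i))" if "i \<in> {1..r}" for i
      using that leading_right_closed HS_word_span[of "{w. (i, w) \<in> leading}" "\<delta> i" \<alpha>]
      by (simp add: I0_def right_closed_def)
    then have "(\<Sum>i=1..r. HS (quot_rmodule (shifted (\<delta> i)) (I0 i)) \<alpha>) = (\<Sum>i=1..r. int (card (?B i)))"
      by (intro sum.cong) simp_all
    also have "\<dots> = int (card (SIGMA i:{1..r}. ?B i))"
      by (subst card_SigmaI) (auto intro: finite_subset[OF _ finite_mdeg_eq])
    also have "(SIGMA i:{1..r}. ?B i) = {m \<in> monomials r - leading. mon_deg \<delta> m = \<alpha>}"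
      by (auto simp: monomials_def mon_deg_def)
    finally show ?thesis by (simp add: HS_quot)
  qed
  have rat: "is_rational_function (HS (quot_rmodule FM M))" if "\<forall>i\<in>{1..r}. regular_ideal (I0 i)"
  proof -
    have ap: "(\<Sum>i\<in>A. F i) \<alpha> = (\<Sum>i\<in>A. F i \<alpha>)" for A \<alpha> and F :: "nat \<Rightarrow> 'x multidegree \<Rightarrow> int"
      by (induction A rule: infinite_finite_induct) simp_all
    have "rational_series (\<Sum>i=1..r. HS (quot_rmodule (shifted (\<delta> i)) (I0 i)))"
    proof (rule rational_series_sum)
      fix i assume i: "i \<in> {1..r}"
      show "rational_series (HS (quot_rmodule (shifted (\<delta> i)) (I0 i)))"
        unfolding HS_quot_shifted[OF PiE_mem[OF I0 i]]
        by (rule rational_series_scale[OF rational_normal_series]) (use that i in blast)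
    qed
    moreover have "HS (quot_rmodule FM M) = (\<Sum>i=1..r. HS (quot_rmodule (shifted (\<delta> i)) (I0 i)))"
      by (rule ext) (simp only: HS ap)
    ultimately show ?thesis by (metis rational_series_imp)
  qed
  show ?thesis
  proof (intro conjI ballI impI)
    show "\<exists>!I. I \<in> {1..r} \<rightarrow>\<^sub>E \<M>\<I> \<and> LM r \<delta> R M = (\<Pi>\<^sub>E i\<in>{1..r}. I i)"
      by (rule ex1I[of _ I0]) (rule conjI[OF I0 LM], elim conjE, rule unique)
    fix I assume I: "I \<in> {1..r} \<rightarrow>\<^sub>E \<M>\<I>" "LM r \<delta> R M = (\<Pi>\<^sub>E i\<in>{1..r}. I i)"
    note eq = unique[OF this]
    show "graded_isomorphic (quot_rmodule (free_module r \<delta>) (LM r \<delta> R M))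
        (dsum_rmodule {1..r} (\<lambda>i. quot_rmodule (shifted (\<delta> i)) (I i)))"
      unfolding eq by (rule iso)
    assume reg: "\<forall>i\<in>{1..r}. regular_ideal (I i)"
    show "HS (quot_rmodule (free_module r \<delta>) M) =
        (\<lambda>\<alpha>. \<Sum>i=1..r. HS (quot_rmodule (shifted (\<delta> i)) (I i)) \<alpha>)"
      unfolding eq by (rule ext) (rule HS)
    show "is_rational_function (HS (quot_rmodule (free_module r \<delta>) M))"
      by (rule rat) (use reg eq in simp)
  qed
qed

end
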